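(* The sets $\mathcal{C}_s$ and $\mathcal{M}_s$ of Borel probability measures on $\mathbb{R}^d$ satisfy $$\mathcal{C}_s^{\perp\perp}=\mathcal{C}_s\ \text{ for all real } s\ge 0,\qquad \mathcal{M}_s^{\perp\perp}=\mathcal{M}_s\ \text{ for all } 0\le s\le d.$$
   Context: $\mathcal{P}(\mathbb{R}^d)$ is the set of Borel probability measures on $\mathbb{R}^d$ and $\mathcal{B}(\mathbb{R}^d)$ is the set of Borel subsets of $\mathbb{R}^d$. For a finite Borel measure $\mu$ on $\mathbb{R}^d$, $\widehat\mu(\xi)=\int e^{-2\pi i \xi\cdot x}\,d\mu(x)$. The notation $f(\xi)\lesssim g(\xi)$ means there is a constant $C$ with $|f(\xi)|\le C|g(\xi)|$ for all $\xi$ (negative powers of $|\xi|$ are read as $+\infty$ at $\xi=0$). The Fourier dimension of $\mu$ is $\dim_{\mathrm{F}}\mu=\sup\{s\in[0,d]:\ \widehat\mu(\xi)\lesssim|\xi|^{-s/2}\}$, and the modified Fourier dimension of $\mu$ is $\dim_{\mathrm{FM}}\mu=\sup\{\dim_{\mathrm{F}}\nu:\ \nu\in\mathcal{P}(\mathbb{R}^d),\ \mu\ll\nu\}$, where $\ll$ denotes absolute continuity. Define $$\mathcal{M}_s=\{\mu\in\mathcal{P}(\mathbb{R}^d):\ \dim_{\mathrm{FM}}\mu\ge s\},$$ $$\mathcal{C}_s=\{\mu\in\mathcal{P}(\mathbb{R}^d):\ \exists\,\nu\in\mathcal{P}(\mathbb{R}^d)\text{ such that }\mu\ll\nu\text{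 and }\widehat\nu(\xi)\lesssim|\xi|^{-s/2}\}.$$ For $\mathcal{C}\subset\mathcal{P}(\mathbb{R}^d)$ let $\mathcal{C}^\perp=\{E\in\mathcal{B}(\mathbb{R}^d):\ \mu(E)=0\text{ for all }\mu\in\mathcal{C}\}$, and for $\mathcal{E}\subset\mathcal{B}(\mathbb{R}^d)$ let $\mathcal{E}^\perp=\{\mu\in\mathcal{P}(\mathbb{R}^d):\ \mu(E)=0\text{ for all }E\in\mathcal{E}\}$; $\mathcal{C}^{\perp\perp}=(\mathcal{C}^\perp)^\perp$. *)

theory Defs
  imports "HOL-Probability.Probability"
begin

definition borel_probs :: "(real ^ 'd) measure set" where
  "borel_probs = {\<mu>. prob_space \<mu> \<and> sets \<mu> = sets borel}"

definition fourier_transform :: "(real ^ 'd) measure \<Rightarrow> real ^ 'd \<Rightarrow> complex" where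
  "fourier_transform \<mu> \<xi> =
     (LINT x|\<mu>. exp (- 2 * complex_of_real pi * \<i> * complex_of_real (\<xi> \<bullet> x)))"

text \<open>
  The origin is excluded because negative powers of \<open>norm \<xi>\<close> are read as infinite there.
  For \<open>s = 0\<close> this changes nothing, since the constant can always be enlarged to bound
  the single value at the origin.
\<close>

definition fourier_decay :: "(real ^ 'd) measure \<Rightarrow> real \<Rightarrow> bool" where
  "fourier_decay \<mu> s \<longleftrightarrow>
     (\<exists>C::real. \<forall>\<xi>. \<xi> \<noteq> 0 \<longrightarrow>
        norm (fourier_transform \<mu> \<xi>) \<le> C * norm \<xi> powr (- s / 2))"

text \<open>
  On \<^const>\<open>borel_probs\<close>, both suprema below are over nonempty subsets of \<open>[0, d]\<close>,
  so they are genuine suprema in the reals. The library's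
  \<^const>\<open>absolutely_continuous\<close> takes the dominating measure first:
  \<open>absolutely_continuous \<nu> \<mu>\<close> is \<open>\<mu> \<lless> \<nu>\<close>.
\<close>

definition fourier_dim :: "(real ^ 'd) measure \<Rightarrow> real" where
  "fourier_dim \<mu> = Sup {s \<in> {0..real CARD('d)}. fourier_decay \<mu> s}"

definition modified_fourier_dim :: "(real ^ 'd) measure \<Rightarrow> real" where
  "modified_fourier_dim \<mu> =
     Sup {fourier_dim \<nu> |\<nu>. \<nu> \<in> borel_probs \<and> absolutely_continuous \<nu> \<mu>}"

definition M_class :: "real \<Rightarrow> (real ^ 'd) measure set" where
  "M_class s = {\<mu> \<in> borel_probs. modified_fourier_dim \<mu> \<ge> s}"

definition C_class :: "real \<Rightarrow> (real ^ 'd) measure set" where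
  "C_class s =
     {\<mu> \<in> borel_probs. \<exists>\<nu>\<in>borel_probs. absolutely_continuous \<nu> \<mu> \<and> fourier_decay \<nu> s}"

definition null_perp :: "(real ^ 'd) measure set \<Rightarrow> (real ^ 'd) set set" where
  "null_perp \<C> = {E \<in> sets borel. \<forall>\<mu>\<in>\<C>. emeasure \<mu> E = 0}"

definition measure_perp :: "(real ^ 'd) set set \<Rightarrow> (real ^ 'd) measure set" where
  "measure_perp \<E> = {\<mu> \<in> borel_probs. \<forall>E\<in>\<E>. emeasure \<mu> E = 0}"

end

theory Submission
  imports Defs
begin

text \<open>
  If \<open>\<mu>\<close> vanishes on all common null sets of the probability measures \<open>\<nu>\<close> with
  Fourier decay of order \<open>s / 2\<close>, take a maximal set \<open>A\<close> on which \<open>\<mu>\<close> is dominated by one such \<open>\<nu>\<close>;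
  it exists because countably many such \<open>\<nu>\<close> can be mixed. Off \<open>A\<close>, \<open>\<mu>\<close> is singular to every \<open>\<nu>\<close> with
  decay. By a minimax argument (in the spirit of Goullet de Rugy, Graham and McGehee) one Borel set then
  carries \<open>\<mu>\<close> off \<open>A\<close> and is null for all these \<open>\<nu>\<close> at once, so \<open>\<mu>\<close> vanishes off \<open>A\<close>.
  Minimax needs weak compactness: multiplying by a Gaussian
  keeps the decay and forces tightness, and a space-filling curve with a Borel section reduces
  compactness on Euclidean space to Helly's theorem on the line.
  The statement for \<^const>\<open>M_class\<close> follows since \<open>M_class s\<close> is the intersection of
  the \<open>C_class t\<close> over \<open>0 \<le> t < s\<close>, within the probability measures.
\<close>

section \<open>A space-filling curve with a Borel section\<close>

text \<open>Singularity gives every \<nu> its own null set carrying \<mu>. There are uncountably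
  many \<nu>, and an intersection of that many sets need be neither Borel nor of full \<mu>-measure.
  Hence sets are replaced by continuous functions, where minimax can trade "an f for each \<nu>" for
  "one f for all \<nu>". Fixing the decay constant K makes the class of \<nu> convex and closed
  under weak limits, but not compact: a translation does not change the modulus of the transform, so
  mass can escape to infinity. The Gaussian weight repairs this. It is an average of characters, so
  weighting \<nu> averages shifts of its transform and only enlarges K; it is positive, so null sets
  stay the same. What remains to be excluded is that the weighted mass tends to 0, and testing
  against the constant function 1 does that. A single K is still too small a class. Letting K = n
  with error 2^(-n) and using Borel-Cantelli gives one set for all K.\<close>

definition triangle_wave :: "real \<Rightarrow> real" where
  "triangle_wave t = arccos (cos (pi * t)) / pi"

text \<open>The wave is the distance to the nearest even integer; writing it with
  \<open>arccos\<close> and \<open>cos\<close> makes periodicity and continuity immediate.\<close>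

lemma triangle_wave_eq:
  fixes k :: int
  assumes "\<bar>r\<bar> \<le> 1"
  shows "triangle_wave (2 * of_int k + r) = \<bar>r\<bar>"
proof -
  have "cos (pi * (2 * of_int k + r)) = cos (pi * r + of_int k * (2 * pi))"
    by (simp add: algebra_simps)
  also have "\<dots> = cos (pi * r)"
    by (simp add: cos_add sin_int_2pin cos_int_2pin mult.commute[of "of_int k"])
  also have "\<dots> = cos (pi * \<bar>r\<bar>)"
    by (cases "0 \<le> r") simp_all
  finally have "triangle_wave (2 * of_int k + r) = arccos (cos (pi * \<bar>r\<bar>)) / pi"
    by (simp add: triangle_wave_def)
  also have "arccos (cos (pi * \<bar>r\<bar>)) = pi * \<bar>r\<bar>"
    using assms by (intro arccos_cos) auto
  finally show ?thesis by simp
qed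

lemma continuous_on_triangle_wave: "continuous_on A triangle_wave"
  unfolding triangle_wave_def by (intro continuous_intros) auto

text \<open>Schoenberg's function: even and 2-periodic, 0 on the first third of [0,1], 1 on the last
  third, linear between them.\<close>

definition plateau :: "real \<Rightarrow> real" where
  "plateau t = max 0 (min 1 (3 * triangle_wave t - 1))"

lemma continuous_on_plateau: "continuous_on A plateau"
  unfolding plateau_def by (intro continuous_intros continuous_on_triangle_wave)

lemma plateau_bounds: "0 \<le> plateau t" "plateau t \<le> 1"
  by (auto simp: plateau_def)

lemma plateau_eq:
  fixes k :: int
  assumes "a = 0 \<or> a = 1" "0 \<le> r" "r \<le> 1/3"
  shows "plateau (2 * of_int k + (2 * a / 3 + r)) = a"
  using assms by (subst plateau_def, subst triangle_wave_eq) auto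

definition cantor_point :: "(nat \<Rightarrow> real) \<Rightarrow> real" where
  "cantor_point a = (\<Sum>m. 2 * a m / 3 ^ Suc m)"

lemma cantor_point_summable:
  assumes "\<And>m. a m \<in> {0..1}"
  shows "summable (\<lambda>m. 2 * a m / 3 ^ Suc m :: real)"
proof (rule summable_comparison_test')
  show "summable (\<lambda>m. 2 * (1/3) ^ Suc m :: real)"
    by (intro summable_mult summable_Suc_iff[THEN iffD2] summable_geometric) auto
  show "norm (2 * a m / 3 ^ Suc m) \<le> 2 * (1/3) ^ Suc m" if "0 \<le> m" for m
    using assms[of m] by (auto simp: field_simps power_divide)
qed

lemma cantor_point_bounds:
  assumes "\<And>m. a m \<in> {0..1}"
  shows "cantor_point a \<in> {0..1}"
proof -
  have 1: "(\<lambda>m. 2 * (1/3) ^ Suc m :: real) sums 1"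
  proof -
    have "(\<lambda>m. (2/3) * (1/3) ^ m :: real) sums ((2/3) * (1 / (1 - 1/3)))"
      by (intro sums_mult geometric_sums) auto
    then show ?thesis by simp
  qed
  have "cantor_point a \<le> (\<Sum>m. 2 * (1/3) ^ Suc m)"
    unfolding cantor_point_def using assms 1
    by (intro suminf_le cantor_point_summable sums_summable[OF 1]) (auto simp: field_simps power_divide)
  moreover have "0 \<le> cantor_point a"
    unfolding cantor_point_def
    by (intro suminf_nonneg cantor_point_summable assms) (use assms in auto)
  ultimately show ?thesis using sums_unique[OF 1] by simp
qed

lemma cantor_point_shift:
  assumes "\<And>m. a m \<in> {0..1}"
  shows "cantor_point a = 2 * a 0 / 3 + cantor_point (\<lambda>m. a (Suc m)) / 3"
proof -
  have "cantor_point a = 2 * a 0 / 3 + (\<Sum>m. 2 * a (Suc m) / 3 ^ Suc (Suc m))"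
    unfolding cantor_point_def
    by (subst suminf_split_head[OF cantor_point_summable, OF assms]) simp
  also have "(\<Sum>m. 2 * a (Suc m) / 3 ^ Suc (Suc m)) = cantor_point (\<lambda>m. a (Suc m)) / 3"
    unfolding cantor_point_def
    by (subst suminf_divide[symmetric, OF cantor_point_summable]) (use assms in \<open>auto simp: mult.commute\<close>)
  finally show ?thesis .
qed

text \<open>Multiplication by 3^m moves m ternary digits in front of the point. These digits are 0
  or 2, so the integer split off is even and a 2-periodic function sees only the shifted
  tail.\<close>

lemma power3_cantor_point:
  assumes "\<And>m. a m = 0 \<or> a m = 1"
  shows "\<exists>k::int. 3 ^ m * cantor_point a = 2 * of_int k + cantor_point (\<lambda>j. a (j + m))"
proof (induction m)
  case 0
  show ?case by (intro exI[of _ 0]) simp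
next
  case (Suc m)
  then obtain k :: int where k: "3 ^ m * cantor_point a = 2 * of_int k + cantor_point (\<lambda>j. a (j + m))"
    by blast
  have "a j \<in> {0..1}" for j using assms[of j] by auto
  then have "cantor_point (\<lambda>j. a (j + m)) = 2 * a m / 3 + cantor_point (\<lambda>j. a (j + Suc m)) / 3"
    using cantor_point_shift[of "\<lambda>j. a (j + m)"] by simp
  \<comment> \<open>The digit crossing the point contributes \<open>2 * a m\<close>; the floor
    merely recasts the real number \<open>a m\<close>, which is 0 or 1, as an integer.\<close>
  then have "3 ^ Suc m * cantor_point a = 2 * of_int (3 * k + \<lfloor>a m\<rfloor>) + cantor_point (\<lambda>j. a (j + Suc m))"
    using k assms[of m] by auto
  then show ?case by blast
qed

text \<open>The Schoenberg trick: the plateaus of \<^const>\<open>plateau\<close> read off base-3 digits in \<open>{0, 2}\<close>.\<close>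

lemma plateau_cantor_point:
  fixes k :: int
  assumes "\<And>m. a m = 0 \<or> a m = 1"
  shows "plateau (3 ^ m * (2 * of_int k + cantor_point a)) = a m"
proof -
  obtain l :: int where l: "3 ^ m * cantor_point a = 2 * of_int l + cantor_point (\<lambda>j. a (j + m))"
    using power3_cantor_point[of a m] assms by blast
  have a01: "a m \<in> {0..1}" for m using assms[of m] by auto
  have b: "cantor_point (\<lambda>j. a (Suc j + m)) \<in> {0..1}"
    using a01 by (intro cantor_point_bounds)
  have "3 ^ m * (2 * of_int k + cantor_point a)
     = 2 * of_int (3 ^ m * k + l) + (2 * a m / 3 + cantor_point (\<lambda>j. a (Suc j + m)) / 3)"
    using cantor_point_shift[of "\<lambda>j. a (j + m)"] a01 l by (simp add: algebra_simps)
  then show ?thesis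
    using plateau_eq[OF assms[of m], of "cantor_point (\<lambda>j. a (Suc j + m)) / 3" "3 ^ m * k + l"] b by simp
qed

section \<open>Binary digits and Schoenberg's curve through the unit cube\<close>

definition bin_digit :: "nat \<Rightarrow> real \<Rightarrow> real" where
  "bin_digit k y = of_int (\<lfloor>2 ^ Suc k * y\<rfloor> - 2 * \<lfloor>2 ^ k * y\<rfloor>)"

lemma bin_digit_01: "bin_digit k y = 0 \<or> bin_digit k y = 1"
proof -
  have "\<lfloor>2 * (2 ^ k * y)\<rfloor> - 2 * \<lfloor>2 ^ k * y\<rfloor> \<in> {0, 1}"
    by (simp only: insert_iff empty_iff) linarith
  then show ?thesis by (auto simp: bin_digit_def mult.assoc)
qed

text \<open>The differences of floors telescope to the dyadic approximation of y from below. At y =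
  1 every digit would be 0, which is why the cubes below are taken half-open.\<close>

lemma bin_digit_sums:
  assumes "0 \<le> y" "y < 1"
  shows "(\<lambda>k. bin_digit k y / 2 ^ Suc k) sums y"
proof -
  have "(\<Sum>k<n. bin_digit k y / 2 ^ Suc k) = of_int \<lfloor>2 ^ n * y\<rfloor> / 2 ^ n" for n
  proof (induction n)
    case 0
    show ?case using assms by (simp add: floor_eq_iff)
  next
    case (Suc n)
    then show ?case by (simp add: bin_digit_def field_simps)
  qed
  moreover have "(\<lambda>n. of_int \<lfloor>2 ^ n * y\<rfloor> / 2 ^ n) \<longlonglongrightarrow> y"
  proof (rule tendsto_sandwich)
    show "\<forall>\<^sub>F n in sequentially. y - (1/2) ^ n \<le> of_int \<lfloor>2 ^ n * y\<rfloor> / 2 ^ n"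
    proof (intro always_eventually allI)
      fix n :: nat
      have "2 ^ n * y - 1 \<le> of_int \<lfloor>2 ^ n * y\<rfloor>" by linarith
      then have "(2 ^ n * y - 1) / 2 ^ n \<le> of_int \<lfloor>2 ^ n * y\<rfloor> / 2 ^ n"
        by (intro divide_right_mono) auto
      then show "y - (1/2) ^ n \<le> of_int \<lfloor>2 ^ n * y\<rfloor> / 2 ^ n"
        by (simp add: diff_divide_distrib power_divide)
    qed
    show "\<forall>\<^sub>F n in sequentially. of_int \<lfloor>2 ^ n * y\<rfloor> / 2 ^ n \<le> y"
      by (intro always_eventually allI) (simp add: field_simps)
    have "(\<lambda>n. y - (1/2) ^ n) \<longlonglongrightarrow> y - 0"
      by (intro tendsto_diff tendsto_const LIMSEQ_power_zero) auto
    then show "(\<lambda>n. y - (1/2) ^ n) \<longlonglongrightarrow> y" by simp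
  qed auto
  ultimately show ?thesis by (simp add: sums_def)
qed

lemma measurable_bin_digit [measurable]: "bin_digit k \<in> borel_measurable borel"
  unfolding bin_digit_def by measurable

text \<open>Interleaving: the digits of all coordinates share one ternary expansion, digit k of
  coordinate i sitting at the place \<open>digit_place (k, i)\<close>.\<close>

abbreviation digit_place :: "nat \<times> 'd::finite \<Rightarrow> nat" where
  "digit_place \<equiv> to_nat_on UNIV"

lemma inj_digit_place: "inj (digit_place :: nat \<times> 'd::finite \<Rightarrow> nat)"
  by (rule inj_on_to_nat_on) (metis countableI_type countable_SIGMA countable_finite finite UNIV_Times_UNIV)

definition schoenberg_curve :: "real \<Rightarrow> real ^ 'd::finite" where
  "schoenberg_curve t = (\<chi> i. \<Sum>k. plateau (3 ^ digit_place (k, i) * t) / 2 ^ Suc k)"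

lemma continuous_on_schoenberg_curve: "continuous_on UNIV schoenberg_curve"
  unfolding schoenberg_curve_def
proof (rule continuous_on_vec_lambda)
  fix i :: 'a
  let ?f = "\<lambda>k t. plateau (3 ^ digit_place (k, i) * t) / 2 ^ Suc k"
  have "uniform_limit UNIV (\<lambda>n x. \<Sum>k<n. ?f k x) (\<lambda>x. \<Sum>k. ?f k x) sequentially"
  proof (rule Weierstrass_m_test)
    show "norm (?f n x) \<le> (1/2) ^ Suc n" for n x
      using plateau_bounds[of "3 ^ digit_place (n, i) * x"] by (simp add: field_simps power_divide)
    show "summable (\<lambda>n. (1/2::real) ^ Suc n)"
      by (intro summable_Suc_iff[THEN iffD2] summable_geometric) auto
  qed
  then show "continuous_on UNIV (\<lambda>x. \<Sum>k. ?f k x)"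
    by (rule uniform_limit_theorem[rotated])
       (auto intro!: always_eventually continuous_intros continuous_on_compose2[OF continuous_on_plateau])
qed

text \<open>A right inverse of the curve on the half-open cube. Binary digits jump, so it is Borel
  but not continuous.\<close>

definition schoenberg_section :: "real ^ 'd::finite \<Rightarrow> real" where
  "schoenberg_section y =
     cantor_point (\<lambda>m. bin_digit (fst (inv digit_place m :: nat \<times> 'd)) (y $ snd (inv digit_place m)))"

lemma schoenberg_section_bounds: "0 \<le> schoenberg_section y" "schoenberg_section y \<le> 1"
proof -
  have "bin_digit k r \<in> {0..1}" for k r using bin_digit_01[of k r] by auto
  then have "schoenberg_section y \<in> {0..1}"
    unfolding schoenberg_section_def by (intro cantor_point_bounds)
  then show "0 \<le> schoenberg_section y" "schoenberg_section y \<le> 1" by auto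
qed

lemma measurable_schoenberg_section [measurable]: "schoenberg_section \<in> borel_measurable borel"
proof -
  have [measurable]: "(\<lambda>y::real^'d. y $ i) \<in> borel_measurable borel" for i
    by (intro borel_measurable_continuous_onI continuous_intros)
  show ?thesis unfolding schoenberg_section_def cantor_point_def by measurable
qed

text \<open>The shift by \<open>2 * k\<close> is invisible because 3^m times an even integer is
  even. It allows each of the growing cubes below to use a unit interval of its own.\<close>

lemma schoenberg_curve_section:
  fixes y :: "real ^ 'd" and k :: int
  assumes "\<And>i. 0 \<le> y $ i" "\<And>i. y $ i < 1"
  shows "schoenberg_curve (2 * of_int k + schoenberg_section y) = y"
proof (rule vec_eq_iff[THEN iffD2], rule allI)
  fix i :: 'd
  have "plateau (3 ^ digit_place (j, i) * (2 * of_int k + schoenberg_section y)) = bin_digit j (y $ i)" for j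
    unfolding schoenberg_section_def
    by (subst plateau_cantor_point) (simp_all add: bin_digit_01 inv_f_f[OF inj_digit_place])
  then show "schoenberg_curve (2 * of_int k + schoenberg_section y) $ i = y $ i"
    using bin_digit_sums[OF assms, of i] by (simp add: schoenberg_curve_def sums_iff)
qed

text \<open>
  \<open>t - triangle_wave t\<close> is constantly \<open>2 * n\<close> on \<open>[2 * n, 2 * n + 1]\<close>, so there the curve below
  runs through the cube \<open>[-n, n]\<^sup>d\<close>.
\<close>

definition euclidean_curve :: "real \<Rightarrow> real ^ 'd" where
  "euclidean_curve t = ((t - triangle_wave t) / 2) *\<^sub>R (2 *\<^sub>R schoenberg_curve t - 1)"

text \<open>Here \<open>1\<close> is the all-ones vector. Since \<open>n\<close> strictly exceeds
  \<open>norm x\<close>, the rescaled point has all coordinates strictly below 1, as the binary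
  expansion requires.\<close>

definition euclidean_section :: "real ^ 'd \<Rightarrow> real" where
  "euclidean_section x = (let n = \<lfloor>norm x\<rfloor> + 1 in
     2 * of_int n + schoenberg_section ((1/2) *\<^sub>R ((1 / of_int n) *\<^sub>R x + 1)))"

lemma continuous_on_euclidean_curve: "continuous_on UNIV euclidean_curve"
  unfolding euclidean_curve_def
  by (intro continuous_intros continuous_on_triangle_wave continuous_on_schoenberg_curve) auto

lemma measurable_euclidean_section [measurable]: "euclidean_section \<in> borel_measurable borel"
  unfolding euclidean_section_def Let_def by measurable

text \<open>Bounded sets go to bounded sets, so tightness on the Euclidean space passes to the
  images on the line.\<close>

lemma euclidean_section_bounds:
  "0 \<le> euclidean_section x" "euclidean_section x \<le> 2 * norm x + 3"
proof -
  define u where "u = schoenberg_section ((1/2) *\<^sub>R ((1 / of_int (\<lfloor>norm x\<rfloor> + 1)) *\<^sub>R x + 1))"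
  have s: "euclidean_section x = 2 * of_int (\<lfloor>norm x\<rfloor> + 1) + u"
    by (simp add: euclidean_section_def Let_def u_def)
  have u: "0 \<le> u" "u \<le> 1" unfolding u_def by (rule schoenberg_section_bounds)+
  have n: "0 \<le> real_of_int \<lfloor>norm x\<rfloor>" "real_of_int \<lfloor>norm x\<rfloor> \<le> norm x" by simp_all
  show "0 \<le> euclidean_section x" using s u n by simp
  have "euclidean_section x = 2 * of_int \<lfloor>norm x\<rfloor> + (2 + u)" using s by simp
  also have "\<dots> \<le> 2 * norm x + (2 + 1)"
    by (intro add_mono mult_left_mono n u) auto
  finally show "euclidean_section x \<le> 2 * norm x + 3" by simp
qed

lemma euclidean_curve_section: "euclidean_curve (euclidean_section x) = x"
proof -
  define n where "n = \<lfloor>norm x\<rfloor> + 1"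
  define y where "y = (1/2) *\<^sub>R ((1 / of_int n) *\<^sub>R x + 1)"
  have n: "norm x < of_int n" "0 < n" "0 < real_of_int n"
    unfolding n_def by (linarith, simp add: floor_correct, use norm_ge_zero[of x] in linarith)
  have xi: "\<bar>x $ i\<bar> < of_int n" for i
    using component_le_norm_cart[of x i] n by linarith
  have y: "0 \<le> y $ i" "y $ i < 1" for i
    using xi[of i] n by (auto simp: y_def field_simps abs_less_iff)
  have s: "euclidean_section x = 2 * of_int n + schoenberg_section y"
    by (simp add: euclidean_section_def Let_def n_def y_def)
  have "triangle_wave (euclidean_section x) = schoenberg_section y"
    unfolding s using triangle_wave_eq[of "schoenberg_section y" n] schoenberg_section_bounds[of y] by simp
  moreover have "schoenberg_curve (euclidean_section x) = y"
    unfolding s by (rule schoenberg_curve_section) (use y in auto)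
  ultimately have "euclidean_curve (euclidean_section x) = of_int n *\<^sub>R (2 *\<^sub>R y - 1)"
    by (simp add: euclidean_curve_def s)
  also have "\<dots> = x" using n by (simp add: y_def)
  finally show ?thesis .
qed

section \<open>Weak compactness\<close>

lemma borel_probsD:
  assumes "\<nu> \<in> borel_probs"
  shows "prob_space \<nu>" "sets \<nu> = sets borel" "space \<nu> = UNIV"
  using assms sets_eq_imp_space_eq[of \<nu> borel] by (auto simp: borel_probs_def)

text \<open>
  The Borel section transports a tight sequence to the line, where Helly's theorem applies;
  the continuous curve carries the limit back.
\<close>

lemma tight_imp_convergent_subsequence:
  fixes \<nu> :: "nat \<Rightarrow> (real ^ 'd) measure"
  assumes \<nu>: "\<And>n. \<nu> n \<in> borel_probs"
    and tight: "\<And>e. e > 0 \<Longrightarrow> \<exists>R. \<forall>n. measure (\<nu> n) {x. R < norm x} \<le> e"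
  obtains r \<tau> where "strict_mono (r :: nat \<Rightarrow> nat)" "\<tau> \<in> borel_probs"
    "\<And>(f :: real ^ 'd \<Rightarrow> complex) B. continuous_on UNIV f \<Longrightarrow> (\<And>x. norm (f x) \<le> B) \<Longrightarrow>
       (\<lambda>n. integral\<^sup>L (\<nu> (r n)) f) \<longlonglongrightarrow> integral\<^sup>L \<tau> f"
proof -
  have [measurable_cong]: "sets (\<nu> n) = sets borel" and space: "space (\<nu> n) = UNIV" for n
    using borel_probsD[OF \<nu>] by auto
  interpret \<nu>: prob_space "\<nu> n" for n using borel_probsD[OF \<nu>] by auto
  have curve [measurable]: "euclidean_curve \<in> borel \<rightarrow>\<^sub>M (borel :: (real ^ 'd) measure)"
    by (intro borel_measurable_continuous_onI continuous_on_euclidean_curve)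
  define \<rho> where "\<rho> n = distr (\<nu> n) borel euclidean_section" for n
  have "real_distribution (\<rho> n)" for n
    unfolding \<rho>_def by (intro \<nu>.real_distribution_distr) simp
  moreover have "\<exists>a b. a < b \<and> (\<forall>n. 1 - e < measure (\<rho> n) {a<..b})" if "e > 0" for e
  proof -
    obtain R where R: "\<And>n. measure (\<nu> n) {x. R < norm x} \<le> e / 2"
      using tight[of "e / 2"] \<open>e > 0\<close> by auto
    \<comment> \<open>The interval is open on the left, so it starts strictly below the lower bound
      0 of the section; the absolute value keeps it nonempty when R is negative.\<close>
    have "1 - e < measure (\<rho> n) {-1<..2 * \<bar>R\<bar> + 3}" for n
    proof -
      have m [measurable]: "{x. R < norm x} \<in> sets (\<nu> n)" by measurable
      have "1 - e < 1 - e / 2" using \<open>e > 0\<close> by simp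
      also have "\<dots> \<le> 1 - measure (\<nu> n) {x. R < norm x}" using R[of n] by simp
      also have "\<dots> = measure (\<nu> n) (space (\<nu> n) - {x. R < norm x})"
        using \<nu>.prob_compl[OF m] by simp
      also have "\<dots> \<le> measure (\<nu> n) (euclidean_section -` {-1<..2 * \<bar>R\<bar> + 3} \<inter> space (\<nu> n))"
      proof (intro \<nu>.finite_measure_mono subsetI)
        fix x assume x: "x \<in> space (\<nu> n) - {x. R < norm x}"
        then show "x \<in> euclidean_section -` {-1<..2 * \<bar>R\<bar> + 3} \<inter> space (\<nu> n)"
          using euclidean_section_bounds[of x] by auto
      qed measurable
      also have "\<dots> = measure (\<rho> n) {-1<..2 * \<bar>R\<bar> + 3}"
        unfolding \<rho>_def by (subst measure_distr) auto
      finally show ?thesis .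
    qed
    moreover have "-1 < 2 * \<bar>R\<bar> + 3" by simp
    ultimately show ?thesis by blast
  qed
  ultimately have "tight \<rho>" by (auto simp: tight_def)
  from tight_imp_convergent_subsubsequence[OF this, of id]
  obtain r M where r: "strict_mono (r :: nat \<Rightarrow> nat)" and M: "real_distribution M"
    and conv: "weak_conv_m (\<rho> \<circ> id \<circ> r) M"
    by (auto simp: strict_mono_id)
  interpret M: real_distribution M by (rule M)
  interpret \<rho>: real_distribution "(\<rho> \<circ> id \<circ> r) n" for n
    using \<open>\<And>n. real_distribution (\<rho> n)\<close> by simp
  define \<tau> where "\<tau> = distr M borel (euclidean_curve :: real \<Rightarrow> real ^ 'd)"
  show ?thesis
  proof
    show "strict_mono r" by fact
    have "prob_space \<tau>"
      unfolding \<tau>_def by (intro M.prob_space_distr) simp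
    then show "\<tau> \<in> borel_probs"
      by (simp add: borel_probs_def \<tau>_def)
    fix f :: "real ^ 'd \<Rightarrow> complex" and B
    assume f: "continuous_on UNIV f" and B: "\<And>x. norm (f x) \<le> B"
    have [measurable]: "f \<in> borel_measurable borel" using f by (intro borel_measurable_continuous_onI)
    have "continuous_on UNIV (\<lambda>t. f (euclidean_curve t))"
      by (intro continuous_on_compose2[OF f continuous_on_euclidean_curve]) auto
    then have "isCont (\<lambda>t. f (euclidean_curve t)) t" for t
      by (simp add: continuous_on_eq_continuous_at)
    then have "(\<lambda>n. integral\<^sup>L ((\<rho> \<circ> id \<circ> r) n) (\<lambda>t. f (euclidean_curve t)))
        \<longlonglongrightarrow> integral\<^sup>L M (\<lambda>t. f (euclidean_curve t))"
      using weak_conv_imp_integral_bdd_continuous_conv[of "\<rho> \<circ> id \<circ> r" M "\<lambda>t. f (euclidean_curve t)" B]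
        conv B M \<open>\<And>n. real_distribution (\<rho> n)\<close> by simp
    \<comment> \<open>The section is not continuous, but it disappears here: the curve after the
      section is the identity. Weak convergence on the line is applied only to f after the curve,
      which is bounded and continuous.\<close>
    moreover have "integral\<^sup>L ((\<rho> \<circ> id \<circ> r) n) (\<lambda>t. f (euclidean_curve t)) = integral\<^sup>L (\<nu> (r n)) f" for n
      unfolding comp_def \<rho>_def id_def by (subst integral_distr) (auto simp: euclidean_curve_section)
    moreover have "integral\<^sup>L \<tau> f = integral\<^sup>L M (\<lambda>t. f (euclidean_curve t))"
      unfolding \<tau>_def by (intro integral_distr) auto
    ultimately show "(\<lambda>n. integral\<^sup>L (\<nu> (r n)) f) \<longlonglongrightarrow> integral\<^sup>L \<tau> f"
      by simp
  qed
qed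

section \<open>Gaussian damping\<close>

definition fourier_character :: "real ^ 'd \<Rightarrow> real ^ 'd \<Rightarrow> complex" where
  "fourier_character \<xi> x = exp (- 2 * complex_of_real pi * \<i> * complex_of_real (\<xi> \<bullet> x))"

lemma fourier_transform_eq: "fourier_transform \<nu> \<xi> = (LINT x|\<nu>. fourier_character \<xi> x)"
  by (simp only: fourier_transform_def fourier_character_def)

lemma norm_fourier_character: "norm (fourier_character \<xi> x) = 1"
  by (simp add: fourier_character_def norm_exp_eq_Re)

lemma fourier_character_add:
  "fourier_character (\<xi> + \<eta>) x = fourier_character \<xi> x * fourier_character \<eta> x"
  by (simp add: fourier_character_def inner_add_left distrib_left flip: exp_add)

lemma continuous_fourier_character: "continuous_on UNIV (fourier_character \<xi>)"
  unfolding fourier_character_def by (intro continuous_intros)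

lemma measurable_fourier_character [measurable]: "fourier_character \<xi> \<in> borel_measurable borel"
  by (intro borel_measurable_continuous_onI continuous_fourier_character)

text \<open>The standard Gaussian in product form, used as a law of random frequencies. Its
  characteristic function and moments thereby reduce to dimension one;
  \<open>\<chi> i. \<omega> i\<close> turns a sample into a vector.\<close>

definition gaussian_product :: "('d::finite \<Rightarrow> real) measure" where
  "gaussian_product = Pi\<^sub>M UNIV (\<lambda>_. std_normal_distribution)"

interpretation gaussian_factor: product_prob_space "\<lambda>_::'d::finite. std_normal_distribution" UNIV
proof -
  interpret real_distribution std_normal_distribution by (rule real_dist_normal_dist)
  show "product_prob_space (\<lambda>_::'d::finite. std_normal_distribution)" ..
qed

interpretation gaussian_product: prob_space "gaussian_product :: ('d::finite \<Rightarrow> real) measure"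
  unfolding gaussian_product_def by (rule gaussian_factor.prob_space_axioms)

lemma measurable_gaussian_vec [measurable]:
  "(\<lambda>\<omega>. \<chi> i. \<omega> i) \<in> gaussian_product \<rightarrow>\<^sub>M (borel :: (real ^ 'd) measure)"
proof -
  have "(\<lambda>\<omega>::'d \<Rightarrow> real. (\<chi> i. \<omega> i) $ j) \<in> borel_measurable gaussian_product" for j
    unfolding gaussian_product_def by simp measurable
  then show ?thesis
    by (subst borel_measurable_euclidean_space) (auto simp: Basis_vec_def inner_axis)
qed

text \<open>The exponent comes from the characteristic function exp(-t^2/2) of the standard normal
  law at t = 2 pi x, the 2 pi being that of the Fourier transform.\<close>

definition gaussian_weight :: "real ^ 'd \<Rightarrow> real" where
  "gaussian_weight x = exp (- 2 * pi\<^sup>2 * (norm x)\<^sup>2)"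

lemma gaussian_weight_bounds: "0 < gaussian_weight x" "gaussian_weight x \<le> 1"
  by (auto simp: gaussian_weight_def)

lemma continuous_gaussian_weight: "continuous_on A gaussian_weight"
  unfolding gaussian_weight_def by (intro continuous_intros)

lemma measurable_gaussian_weight [measurable]: "gaussian_weight \<in> borel_measurable borel"
  by (intro borel_measurable_continuous_onI continuous_gaussian_weight)

lemma gaussian_weight_eq:
  fixes x :: "real ^ 'd"
  shows "(LINT \<omega>|gaussian_product. fourier_character (\<chi> i. \<omega> i) x) = complex_of_real (gaussian_weight x)"
proof -
  have "fourier_character (\<chi> i. \<omega> i) x = (\<Prod>i\<in>UNIV. iexp (- 2 * pi * x $ i * \<omega> i))" for \<omega>
    by (simp add: fourier_character_def inner_vec_def exp_sum[symmetric] sum_distrib_left sum_negf algebra_simps)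
  then have "(LINT \<omega>|gaussian_product. fourier_character (\<chi> i. \<omega> i) x)
      = (\<integral>\<omega>. (\<Prod>i\<in>UNIV. iexp (- 2 * pi * x $ i * \<omega> i)) \<partial>Pi\<^sub>M UNIV (\<lambda>_::'d. std_normal_distribution))"
    by (simp add: gaussian_product_def)
  also have "\<dots> = (\<Prod>i\<in>UNIV. char std_normal_distribution (- 2 * pi * x $ i))"
    unfolding char_def by (intro gaussian_factor.product_integral_prod
        prob_space.integrable_iexp[OF real_distribution.axioms(1)[OF real_dist_normal_dist]]) auto
  also have "\<dots> = complex_of_real (\<Prod>i\<in>UNIV. exp (- 2 * pi\<^sup>2 * (x $ i)\<^sup>2))"
    by (simp add: char_std_normal_distribution power_mult_distrib mult.assoc)
  also have "(\<Prod>i\<in>UNIV. exp (- 2 * pi\<^sup>2 * (x $ i)\<^sup>2)) = gaussian_weight x"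
    by (simp add: gaussian_weight_def exp_sum[symmetric] norm_vec_def L2_set_def sum_nonneg sum_distrib_left sum_negf)
  finally show ?thesis .
qed

text \<open>Expanding the product yields the left side plus nonnegative terms. This turns a bound by
  the l1 norm into a product over coordinates, which a product measure can integrate.\<close>

lemma one_plus_sum_le_prod:
  fixes f :: "'a \<Rightarrow> real"
  assumes "finite A" "\<And>i. i \<in> A \<Longrightarrow> 0 \<le> f i"
  shows "1 + sum f A \<le> (\<Prod>i\<in>A. 1 + f i)"
  using assms
proof (induction A rule: finite_induct)
  case (insert i A)
  have "1 + sum f (insert i A) \<le> (1 + f i) * (1 + sum f A)"
    using insert by (simp add: algebra_simps sum_nonneg)
  also have "\<dots> \<le> (1 + f i) * (\<Prod>i\<in>A. 1 + f i)"
    using insert by (intro mult_left_mono) auto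
  finally show ?case using insert by simp
qed simp

text \<open>The norm is at most the l1 norm, so the integrand is dominated by a product of
  one-dimensional polynomials. The exponent is first rounded up to a natural number \<open>k\<close>
  so that the binomial theorem applies to each factor.\<close>

lemma integrable_gaussian_moment:
  assumes "0 \<le> r"
  shows "integrable gaussian_product (\<lambda>\<omega>. (1 + norm (\<chi> i. \<omega> i :: real ^ 'd)) powr r)"
proof -
  define k where "k = nat \<lceil>r\<rceil>"
  have "integrable std_normal_distribution (\<lambda>t. (1 + \<bar>t\<bar>) ^ k)"
  proof -
    have "integrable lborel (\<lambda>t. std_normal_density t * (1 + \<bar>t\<bar>) ^ k)"
    proof -
      have "(\<lambda>t. std_normal_density t * (1 + \<bar>t\<bar>) ^ k)
          = (\<lambda>t. \<Sum>n\<le>k. real (k choose n) * (std_normal_density t * \<bar>t\<bar> ^ (k - n)))"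
        unfolding binomial_ring sum_distrib_left by (simp add: mult.left_commute)
      then show ?thesis
        by (simp only:) (intro Bochner_Integration.integrable_sum integrable_mult_right integrable_std_normal_moment_abs)
    qed
    then show ?thesis by (subst integrable_density) (auto simp: normal_density_nonneg)
  qed
  then have "integrable gaussian_product (\<lambda>\<omega>::'d \<Rightarrow> real. \<Prod>i\<in>UNIV. (1 + \<bar>\<omega> i\<bar>) ^ k)"
    unfolding gaussian_product_def by (intro gaussian_factor.product_integrable_prod) auto
  then show ?thesis
  proof (rule Bochner_Integration.integrable_bound)
    show "AE \<omega> in gaussian_product. norm ((1 + norm (\<chi> i. \<omega> i :: real ^ 'd)) powr r)
        \<le> norm (\<Prod>i\<in>UNIV. (1 + \<bar>\<omega> i\<bar>) ^ k)"
    proof (rule AE_I2)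
      fix \<omega> :: "'d \<Rightarrow> real"
      have "(1 + norm (\<chi> i. \<omega> i :: real ^ 'd)) powr r \<le> (1 + norm (\<chi> i. \<omega> i :: real ^ 'd)) powr real k"
        using assms by (intro powr_mono) (auto simp: k_def)
      also have "\<dots> = (1 + norm (\<chi> i. \<omega> i :: real ^ 'd)) ^ k"
        by (intro powr_realpow) (simp add: add_pos_nonneg)
      also have "\<dots> \<le> (1 + (\<Sum>i\<in>UNIV. \<bar>\<omega> i\<bar>)) ^ k"
        using norm_le_l1_cart[of "\<chi> i. \<omega> i :: real ^ 'd"] by (intro power_mono) auto
      also have "\<dots> \<le> (\<Prod>i\<in>UNIV. (1 + \<bar>\<omega> i\<bar>)) ^ k"
        by (intro power_mono one_plus_sum_le_prod) (auto intro!: add_nonneg_nonneg sum_nonneg)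
      finally show "norm ((1 + norm (\<chi> i. \<omega> i :: real ^ 'd)) powr r)
        \<le> norm (\<Prod>i\<in>UNIV. (1 + \<bar>\<omega> i\<bar>) ^ k)"
        by (simp add: prod_power_distrib abs_prod)
    qed
  qed measurable
qed

text \<open>Raise 1 + |\<xi>| \<le> (1 + |\<xi> + a|) (1 + |a|) to the power r. Shifting a frequency
  by a thus costs only a polynomial factor in a, which Gaussian averaging absorbs.\<close>

lemma peetre_inequality:
  fixes \<xi> a :: "'a::real_normed_vector"
  assumes "0 \<le> r"
  shows "(1 + norm (\<xi> + a)) powr - r \<le> (1 + norm a) powr r * (1 + norm \<xi>) powr - r"
proof -
  have "norm \<xi> \<le> norm (\<xi> + a) + norm a"
    by (metis add_diff_cancel_right' norm_triangle_ineq4)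
  also have "\<dots> \<le> norm (\<xi> + a) + norm a + norm (\<xi> + a) * norm a" by simp
  finally have "1 + norm \<xi> \<le> (1 + norm (\<xi> + a)) * (1 + norm a)"
    by (simp add: algebra_simps)
  then have "(1 + norm \<xi>) powr r \<le> ((1 + norm (\<xi> + a)) * (1 + norm a)) powr r"
    using assms by (intro powr_mono2) auto
  also have "\<dots> = (1 + norm (\<xi> + a)) powr r * (1 + norm a) powr r"
    by (rule powr_mult)
  finally have *: "(1 + norm \<xi>) powr r \<le> (1 + norm (\<xi> + a)) powr r * (1 + norm a) powr r" .
  have "0 < 1 + norm \<xi>" "0 < 1 + norm (\<xi> + a)" by (simp_all add: add_pos_nonneg)
  then have "0 < (1 + norm \<xi>) powr r" "0 < (1 + norm (\<xi> + a)) powr r" by simp_all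
  then show ?thesis using * by (simp add: powr_minus field_simps)
qed

text \<open>Decay with an explicit constant, where r stands for s/2. For fixed \<open>K\<close> the
  class is convex and weakly closed; the weight 1 + |\<xi>| avoids the singularity at the origin and
  is monotone in the exponent.\<close>

definition decay_bounded :: "real \<Rightarrow> real \<Rightarrow> (real ^ 'd) measure set" where
  "decay_bounded r K = {\<nu> \<in> borel_probs. \<forall>\<xi>. norm (fourier_transform \<nu> \<xi>) \<le> K * (1 + norm \<xi>) powr - r}"

lemma integrable_fourier_character:
  assumes "finite_measure M" "sets M = sets borel"
  shows "integrable M (fourier_character \<xi>)"
proof -
  interpret finite_measure M by fact
  have [measurable_cong]: "sets M = sets borel" by fact
  show ?thesis
    by (rule integrable_const_bound[where B = 1]) (auto simp: norm_fourier_character)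
qed

lemma norm_fourier_transform_le_1:
  assumes "\<nu> \<in> borel_probs"
  shows "norm (fourier_transform \<nu> \<xi>) \<le> 1"
proof -
  interpret prob_space \<nu> using borel_probsD[OF assms] by simp
  have "norm (fourier_transform \<nu> \<xi>) \<le> (LINT x|\<nu>. norm (fourier_character \<xi> x))"
    unfolding fourier_transform_eq by (rule integral_norm_bound)
  then show ?thesis by (simp add: norm_fourier_character prob_space)
qed

text \<open>The weight is the mean of characters with Gaussian frequency, and a product of
  characters adds frequencies. Fubini for a bounded integrand then gives the mean of shifted
  transforms, that is, a convolution.\<close>

lemma fourier_transform_damped:
  fixes \<nu> :: "(real ^ 'd) measure"
  assumes \<nu>: "\<nu> \<in> borel_probs" and "0 \<le> c"
  shows "fourier_transform (density \<nu> (\<lambda>x. ennreal (c * gaussian_weight x))) \<xi>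
    = c * (LINT \<omega>|gaussian_product. fourier_transform \<nu> (\<xi> + (\<chi> i. \<omega> i)))"
proof -
  interpret prob_space \<nu> using borel_probsD[OF \<nu>] by simp
  have [measurable_cong]: "sets \<nu> = sets borel" using borel_probsD[OF \<nu>] by simp
  interpret pair_prob_space "gaussian_product :: ('d \<Rightarrow> real) measure" \<nu> ..
  let ?v = "\<lambda>\<omega>. \<chi> i. \<omega> i :: real ^ 'd"
  have "fourier_transform (density \<nu> (\<lambda>x. ennreal (c * gaussian_weight x))) \<xi>
      = (LINT x|\<nu>. (c * gaussian_weight x) *\<^sub>R fourier_character \<xi> x)"
    unfolding fourier_transform_eq using \<open>0 \<le> c\<close>
    by (subst integral_density)
       (auto intro!: AE_I2 mult_nonneg_nonneg less_imp_le[OF gaussian_weight_bounds(1)])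
  also have "\<dots> = (LINT x|\<nu>. c * (LINT \<omega>|gaussian_product. fourier_character (\<xi> + ?v \<omega>) x))"
    by (simp add: fourier_character_add gaussian_weight_eq scaleR_conv_of_real ac_simps)
  also have "\<dots> = c * (LINT x|\<nu>. LINT \<omega>|gaussian_product. fourier_character (\<xi> + ?v \<omega>) x)"
    by simp
  also have "(LINT x|\<nu>. LINT \<omega>|gaussian_product. fourier_character (\<xi> + ?v \<omega>) x)
      = (LINT \<omega>|gaussian_product. LINT x|\<nu>. fourier_character (\<xi> + ?v \<omega>) x)"
  proof (rule Fubini_integral)
    show "integrable (gaussian_product \<Otimes>\<^sub>M \<nu>) (\<lambda>(\<omega>, x). fourier_character (\<xi> + ?v \<omega>) x)"
      by (rule P.integrable_const_bound[where B = 1])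
         (auto simp: norm_fourier_character split_beta, simp add: fourier_character_def)
  qed
  finally show ?thesis unfolding fourier_transform_eq .
qed

text \<open>The factor by which damping enlarges a decay constant. The \<open>itself\<close>
  argument carries the dimension, which the type \<open>real\<close> of the result cannot
  determine.\<close>

definition gaussian_moment :: "'d::finite itself \<Rightarrow> real \<Rightarrow> real" where
  "gaussian_moment _ r = (LINT \<omega>|gaussian_product. (1 + norm (\<chi> i. \<omega> i :: real ^ 'd)) powr r)"

text \<open>Peetre's inequality inside the Gaussian average yields the moment; normalising to total
  mass 1 yields 1/m. The new constant is uniform over any family whose weighted mass
  \<open>m\<close> is bounded below.\<close>

lemma decay_bounded_damped:
  fixes \<nu> :: "(real ^ 'd) measure"
  assumes \<nu>: "\<nu> \<in> decay_bounded r K" and "0 \<le> r" "0 < m"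
    and m: "(LINT x|\<nu>. gaussian_weight x) = m"
  shows "density \<nu> (\<lambda>x. ennreal (1 / m * gaussian_weight x))
    \<in> decay_bounded r (K * gaussian_moment TYPE('d) r / m)"
proof -
  let ?\<rho> = "density \<nu> (\<lambda>x. ennreal (1 / m * gaussian_weight x))"
  have \<nu>': "\<nu> \<in> borel_probs" using \<nu> by (simp add: decay_bounded_def)
  interpret prob_space \<nu> using borel_probsD[OF \<nu>'] by simp
  have [measurable_cong]: "sets \<nu> = sets borel" using borel_probsD[OF \<nu>'] by simp
  have "integrable \<nu> gaussian_weight"
    by (rule integrable_const_bound[where B = 1])
       (auto simp: gaussian_weight_bounds less_imp_le abs_of_pos)
  then have "(\<integral>\<^sup>+x. ennreal (1 / m * gaussian_weight x) \<partial>\<nu>) = ennreal (LINT x|\<nu>. 1 / m * gaussian_weight x)"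
    using \<open>0 < m\<close> by (intro nn_integral_eq_integral integrable_mult_right)
      (auto simp: gaussian_weight_bounds less_imp_le)
  then have "emeasure ?\<rho> (space \<nu>) = ennreal (LINT x|\<nu>. 1 / m * gaussian_weight x)"
    by (subst emeasure_density) (auto cong: nn_integral_cong)
  then have "prob_space ?\<rho>"
    using \<open>0 < m\<close> m by (intro prob_spaceI) simp
  then have "?\<rho> \<in> borel_probs"
    using borel_probsD[OF \<nu>'] by (simp add: borel_probs_def)
  moreover have "norm (fourier_transform ?\<rho> \<xi>) \<le> K * gaussian_moment TYPE('d) r / m * (1 + norm \<xi>) powr - r" for \<xi>
  proof -
    let ?v = "\<lambda>\<omega>. \<chi> i. \<omega> i :: real ^ 'd"
    have K: "norm (fourier_transform \<nu> \<eta>) \<le> K * (1 + norm \<eta>) powr - r" for \<eta>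
      using \<nu> by (simp add: decay_bounded_def)
    have "0 \<le> K" using order_trans[OF norm_ge_zero K[of 0]] by simp
    have "norm (LINT \<omega>|gaussian_product. fourier_transform \<nu> (\<xi> + ?v \<omega>))
        \<le> (LINT \<omega>|gaussian_product. K * (1 + norm \<xi>) powr - r * (1 + norm (?v \<omega>)) powr r)"
    proof (rule order_trans[OF integral_norm_bound integral_mono'])
      show "integrable gaussian_product (\<lambda>\<omega>. K * (1 + norm \<xi>) powr - r * (1 + norm (?v \<omega>)) powr r)"
        by (intro integrable_mult_right integrable_gaussian_moment \<open>0 \<le> r\<close>)
      show "norm (fourier_transform \<nu> (\<xi> + ?v \<omega>)) \<le> K * (1 + norm \<xi>) powr - r * (1 + norm (?v \<omega>)) powr r" for \<omega>
        using order_trans[OF K[of "\<xi> + ?v \<omega>"] mult_left_mono[OF peetre_inequality[OF \<open>0 \<le> r\<close>, of \<xi> "?v \<omega>"] \<open>0 \<le> K\<close>]]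
        by (simp only: ac_simps)
    qed (use \<open>0 \<le> K\<close> in auto)
    also have "\<dots> = K * gaussian_moment TYPE('d) r * (1 + norm \<xi>) powr - r"
      by (simp add: gaussian_moment_def)
    finally have "norm (LINT \<omega>|gaussian_product. fourier_transform \<nu> (\<xi> + ?v \<omega>))
        \<le> K * gaussian_moment TYPE('d) r * (1 + norm \<xi>) powr - r" .
    then have "1 / m * norm (LINT \<omega>|gaussian_product. fourier_transform \<nu> (\<xi> + ?v \<omega>))
        \<le> 1 / m * (K * gaussian_moment TYPE('d) r * (1 + norm \<xi>) powr - r)"
      using \<open>0 < m\<close> by (intro mult_left_mono) auto
    then show ?thesis
      using \<open>0 < m\<close> by (subst fourier_transform_damped[OF \<nu>']) (simp_all add: norm_mult norm_divide)
  qed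
  ultimately show ?thesis by (simp add: decay_bounded_def)
qed

section \<open>Minimax\<close>

text \<open>A line separates S from the open quadrant. The quadrant is unbounded in both coordinate
  directions, which forces nonnegative coefficients; dividing by their sum gives t and 1 -
  t.\<close>

lemma separated_from_quadrant:
  fixes S :: "(real \<times> real) set"
  assumes "convex S" "S \<noteq> {}" and "\<And>x y. (x, y) \<in> S \<Longrightarrow> \<not> (c < x \<and> c < y)"
  shows "\<exists>t. 0 \<le> t \<and> t \<le> 1 \<and> (\<forall>(x, y)\<in>S. t * x + (1 - t) * y \<le> c)"
proof -
  let ?T = "{c<..} \<times> {c<..}"
  have "convex ?T" by (intro convex_Times) (simp_all add: convex_real_interval)
  moreover have "(c + 1, c + 1) \<in> ?T" by simp
  moreover have "S \<inter> ?T = {}" using assms(3) by blast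
  ultimately obtain ab \<beta> where ab: "ab \<noteq> 0" "\<forall>z\<in>S. ab \<bullet> z \<le> \<beta>" "\<forall>z\<in>?T. ab \<bullet> z \<ge> \<beta>"
    using separating_hyperplane_sets[OF \<open>convex S\<close> _ \<open>S \<noteq> {}\<close>, of ?T] by blast
  obtain a b where ab_eq: "ab = (a, b)" by fastforce
  have S: "a * x + b * y \<le> \<beta>" if "(x, y) \<in> S" for x y using ab(2) that ab_eq by auto
  have T: "\<beta> \<le> a * x + b * y" if "c < x" "c < y" for x y using ab(3) that ab_eq by auto
  have "0 \<le> a"
  proof (rule ccontr)
    assume "\<not> 0 \<le> a"
    \<comment> \<open>Moving by \<open>N\<close> along the quadrant lowers the linear form by more
      than its distance to the bound \<beta>, contradicting the separation.\<close>
    define N where "N = (\<bar>a * (c + 1) + b * (c + 1) - \<beta>\<bar> + 1) / (- a)"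
    have N: "0 < N" "a * N = - (\<bar>a * (c + 1) + b * (c + 1) - \<beta>\<bar> + 1)"
      using \<open>\<not> 0 \<le> a\<close> by (auto simp: N_def intro!: divide_pos_neg)
    have "\<beta> \<le> a * (c + 1 + N) + b * (c + 1)" using N by (intro T) auto
    then have "\<beta> \<le> a * (c + 1) + b * (c + 1) + a * N" by (simp add: algebra_simps)
    then show False using N by linarith
  qed
  moreover have "0 \<le> b"
  proof (rule ccontr)
    assume "\<not> 0 \<le> b"
    define N where "N = (\<bar>a * (c + 1) + b * (c + 1) - \<beta>\<bar> + 1) / (- b)"
    have N: "0 < N" "b * N = - (\<bar>a * (c + 1) + b * (c + 1) - \<beta>\<bar> + 1)"
      using \<open>\<not> 0 \<le> b\<close> by (auto simp: N_def intro!: divide_pos_neg)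
    have "\<beta> \<le> a * (c + 1) + b * (c + 1 + N)" using N by (intro T) auto
    then have "\<beta> \<le> a * (c + 1) + b * (c + 1) + b * N" by (simp add: algebra_simps)
    then show False using N by linarith
  qed
  moreover have "a \<noteq> 0 \<or> b \<noteq> 0" using ab(1) ab_eq by (auto simp: zero_prod_def)
  ultimately have pos: "0 < a + b" by linarith
  \<comment> \<open>The corner (c, c) lies outside the open quadrant and is approached along the
    diagonal.\<close>
  have \<beta>: "\<beta> \<le> (a + b) * c"
  proof (rule field_le_epsilon)
    fix e :: real assume "0 < e"
    then have "\<beta> \<le> a * (c + e / (a + b)) + b * (c + e / (a + b))" using pos by (intro T) auto
    also have "\<dots> = (a + b) * (c + e / (a + b))" by (rule distrib_right[symmetric])
    also have "\<dots> = (a + b) * c + (a + b) * (e / (a + b))" by (rule distrib_left)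
    also have "\<dots> = (a + b) * c + e"
      by (subst times_divide_eq_right, subst nonzero_mult_div_cancel_left) (use pos in auto)
    finally show "\<beta> \<le> (a + b) * c + e" .
  qed
  have t1: "1 - a / (a + b) = b / (a + b)" using pos by (simp add: field_simps)
  have "a / (a + b) * x + (1 - a / (a + b)) * y \<le> c" if "(x, y) \<in> S" for x y
  proof -
    have "a / (a + b) * x + (1 - a / (a + b)) * y = (a * x + b * y) / (a + b)"
      unfolding t1 by (simp add: add_divide_distrib)
    also have "\<dots> \<le> c" using S[OF that] \<beta> pos by (simp add: field_simps)
    finally show ?thesis .
  qed
  then show ?thesis using \<open>0 \<le> a\<close> \<open>0 \<le> b\<close> pos by (intro exI[of _ "a / (a + b)"]) auto
qed

text \<open>
  Induction on the finite set \<open>G\<close>: each member is turned into a constraint that shrinks the convex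
  family \<open>V\<close>, and the two-function case is a separation in the plane.
\<close>

lemma minimax_finite:
  fixes V :: "(('x \<Rightarrow> real) \<Rightarrow> real) set" and F :: "('x \<Rightarrow> real) set"
  assumes "finite G" "G \<subseteq> F" "V \<noteq> {}"
    and V: "\<And>u v t. u \<in> V \<Longrightarrow> v \<in> V \<Longrightarrow> 0 \<le> t \<Longrightarrow> t \<le> 1 \<Longrightarrow>
      \<exists>w\<in>V. \<forall>f\<in>F. w f = t * u f + (1 - t) * v f"
    and F: "\<And>f g t. f \<in> F \<Longrightarrow> g \<in> F \<Longrightarrow> 0 \<le> t \<Longrightarrow> t \<le> 1 \<Longrightarrow> (\<lambda>x. t * f x + (1 - t) * g x) \<in> F"
    and affine: "\<And>v f g t. v \<in> V \<Longrightarrow> f \<in> F \<Longrightarrow> g \<in> F \<Longrightarrow> 0 \<le> t \<Longrightarrow> t \<le> 1 \<Longrightarrow>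
      v (\<lambda>x. t * f x + (1 - t) * g x) = t * v f + (1 - t) * v g"
    and ex: "\<And>f. f \<in> F \<Longrightarrow> \<exists>v\<in>V. c < v f"
  shows "\<exists>v\<in>V. \<forall>f\<in>G. c < v f"
  using assms(1-4) affine ex
proof (induction G arbitrary: V rule: finite_induct)
  case empty
  then show ?case by blast
next
  case (insert f\<^sub>0 G)
  note V = insert.prems(3) and affine = insert.prems(4) and ex = insert.prems(5)
  have f\<^sub>0: "f\<^sub>0 \<in> F" using insert.prems by auto
  let ?V' = "{v \<in> V. c < v f\<^sub>0}"
  \<comment> \<open>If no member of the shrunken family exceeded c at \<open>f\<close>, the points
    \<open>(v f, v f\<^sub>0)\<close> would all miss the quadrant. The t from the separation then
    makes a convex combination of \<open>f\<close> and \<open>f\<^sub>0\<close> a single element of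
    F at which no member of V exceeds c.\<close>
  have "\<exists>v\<in>?V'. c < v f" if f: "f \<in> F" for f
  proof (rule ccontr)
    assume neg: "\<not> (\<exists>v\<in>?V'. c < v f)"
    let ?S = "(\<lambda>v. (v f, v f\<^sub>0)) ` V"
    have "convex ?S"
    proof (rule convexI)
      fix x y :: "real \<times> real" and p q :: real
      assume "x \<in> ?S" "y \<in> ?S" and pq: "0 \<le> p" "0 \<le> q" "p + q = 1"
      then obtain u v where uv: "u \<in> V" "v \<in> V" "x = (u f, u f\<^sub>0)" "y = (v f, v f\<^sub>0)" by auto
      have q: "q = 1 - p" using pq by simp
      obtain w where "w \<in> V" "\<forall>f\<in>F. w f = p * u f + (1 - p) * v f"
        using V[of u v p] uv pq by auto
      then have "p *\<^sub>R x + q *\<^sub>R y = (w f, w f\<^sub>0)" using uv q f f\<^sub>0 by simp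
      then show "p *\<^sub>R x + q *\<^sub>R y \<in> ?S" using \<open>w \<in> V\<close> by blast
    qed
    moreover have "?S \<noteq> {}" using \<open>V \<noteq> {}\<close> by blast
    moreover have "\<not> (c < x \<and> c < y)" if "(x, y) \<in> ?S" for x y using that neg by auto
    ultimately obtain t where t: "0 \<le> t" "t \<le> 1" "\<forall>(x, y)\<in>?S. t * x + (1 - t) * y \<le> c"
      using separated_from_quadrant by blast
    obtain v where "v \<in> V" "c < v (\<lambda>x. t * f x + (1 - t) * f\<^sub>0 x)"
      using ex[OF F[OF f f\<^sub>0 t(1,2)]] by blast
    then show False using affine[OF \<open>v \<in> V\<close> f f\<^sub>0 t(1,2)] t(3) by fastforce
  qed
  moreover have "\<exists>w\<in>?V'. \<forall>f\<in>F. w f = t * u f + (1 - t) * v f"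
    if uv: "u \<in> ?V'" "v \<in> ?V'" and t: "0 \<le> t" "t \<le> 1" for u v t
  proof -
    obtain w where w: "w \<in> V" "\<forall>f\<in>F. w f = t * u f + (1 - t) * v f"
      using V[of u v t] uv t by auto
    have "c < t * u f\<^sub>0 + (1 - t) * v f\<^sub>0"
      using convex_real_interval(3)[of c] uv t by (auto simp: convex_def)
    then show ?thesis using w f\<^sub>0 by auto
  qed
  moreover have "?V' \<noteq> {}" using ex[OF f\<^sub>0] by auto
  ultimately have "\<exists>v\<in>?V'. \<forall>f\<in>G. c < v f"
    using insert.prems(1) affine by (intro insert.IH) auto
  then show ?case by auto
qed

text \<open>Countability lets a sequence of measures be tested against ever larger finite parts of
  one family, so that every test function is eventually covered. The functions are truncated
  multiples of finite sums of distances to complements of basic open sets; growing sums fill up any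
  open set from inside.\<close>

lemma countable_test_functions:
  obtains \<Phi> :: "('a::{metric_space, second_countable_topology} \<Rightarrow> real) set"
  where "countable \<Phi>" "\<And>f. f \<in> \<Phi> \<Longrightarrow> continuous_on UNIV f" "\<And>f x. f \<in> \<Phi> \<Longrightarrow> f x \<in> {0..1}"
    and "\<And>U. open U \<Longrightarrow> \<exists>f. range f \<subseteq> \<Phi> \<and> (\<forall>n x. f n x \<le> indicator U x) \<and>
      (\<forall>x. (\<lambda>n::nat. f n x) \<longlonglongrightarrow> indicator U x)"
proof -
  obtain B :: "'a set set" where B: "countable B" "topological_basis B"
    using ex_countable_basis by blast
  \<comment> \<open>\<open>infdist x {}\<close> is \<open>0\<close>, hence the case distinction.\<close>
  define d where "d b x = (if b = UNIV then 1 else infdist x (- b))" for b and x :: 'a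
  define \<phi> where "\<phi> = (\<lambda>(A, n::nat) x. min 1 (real n * (\<Sum>b\<in>A. d b x)))"
  define \<Phi> where "\<Phi> = \<phi> ` ({A. finite A \<and> A \<subseteq> B} \<times> UNIV)"
  have d_nonneg: "0 \<le> d b x" for b x by (simp add: d_def infdist_nonneg)
  have d_out: "d b x = 0" if "x \<notin> b" for b x using that by (auto simp: d_def)
  have d_in: "0 < d b x" if "x \<in> b" "open b" for b x
  proof (cases "b = UNIV")
    case False
    then have "infdist x (- b) \<noteq> 0"
      using that in_closed_iff_infdist_zero[of "- b" x] by (auto simp: closed_def)
    then show ?thesis using False infdist_nonneg[of x "- b"] by (simp add: d_def)
  qed (simp add: d_def)
  have cont: "continuous_on UNIV (d b)" for b
    unfolding d_def by (cases "b = UNIV") (auto intro!: continuous_intros)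
  show thesis
  proof
    show "countable \<Phi>"
      unfolding \<Phi>_def using B by (intro countable_image countable_SIGMA countable_Collect_finite_subset) auto
    show "continuous_on UNIV f" if f: "f \<in> \<Phi>" for f
      using f cont unfolding \<Phi>_def \<phi>_def by (auto intro!: continuous_intros)
    show "f x \<in> {0..1}" if f: "f \<in> \<Phi>" for f x
      using f d_nonneg unfolding \<Phi>_def \<phi>_def by (auto intro!: sum_nonneg mult_nonneg_nonneg)
    fix U :: "'a set" assume "open U"
    then obtain B' where B': "B' \<subseteq> B" "\<Union>B' = U" using B unfolding topological_basis_def by blast
    define A where "A n = {b \<in> B'. to_nat_on B b < n}" for n
    have A: "finite (A n)" "A n \<subseteq> B" for n
    proof -
      have "inj_on (to_nat_on B) (A n)"
        using B'(1) by (intro inj_on_subset[OF inj_on_to_nat_on[OF B(1)]]) (auto simp: A_def)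
      moreover have "to_nat_on B ` A n \<subseteq> {..<n}" by (auto simp: A_def)
      ultimately show "finite (A n)" by (metis finite_imageD finite_lessThan finite_subset)
      show "A n \<subseteq> B" using B' by (auto simp: A_def)
    qed
    define f where "f n = \<phi> (A n, n)" for n
    have zero: "f n x = 0" if "x \<notin> U" for n x
      using that B' d_out by (auto simp: f_def \<phi>_def A_def intro!: sum.neutral)
    have "(\<lambda>n. f n x) \<longlonglongrightarrow> indicator U x" for x
    proof (cases "x \<in> U")
      case True
      then obtain b where b: "b \<in> B'" "x \<in> b" using B' by blast
      then have "open b" using B B' topological_basis_open by blast
      with b have pos: "0 < d b x" by (intro d_in)
      \<comment> \<open>Past this index the basic set \<open>b\<close> has entered
        \<open>A n\<close>, and the multiplier has made its term at least 1, where the truncation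
        acts.\<close>
      have "f n x = 1" if n: "n \<ge> Suc (to_nat_on B b) + nat \<lceil>1 / d b x\<rceil>" for n
      proof -
        have "1 / d b x \<le> real n" using n by linarith
        then have "1 \<le> real n * d b x" using pos by (simp add: field_simps)
        also have "\<dots> \<le> real n * (\<Sum>b\<in>A n. d b x)"
          using n b A d_nonneg by (intro mult_left_mono member_le_sum) (auto simp: A_def)
        finally show ?thesis by (simp add: f_def \<phi>_def)
      qed
      then have "\<forall>\<^sub>F n in sequentially. f n x = 1"
        by (rule eventually_sequentiallyI)
      then show ?thesis using True by (simp add: tendsto_eventually)
    qed (simp add: zero)
    moreover have "f n x \<le> indicator U x" for n x
      by (cases "x \<in> U") (auto simp: zero, simp add: f_def \<phi>_def)
    moreover have "range f \<subseteq> \<Phi>" using A by (auto simp: f_def \<Phi>_def)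
    ultimately show "\<exists>f. range f \<subseteq> \<Phi> \<and> (\<forall>n x. f n x \<le> indicator U x) \<and>
      (\<forall>x. (\<lambda>n::nat. f n x) \<longlonglongrightarrow> indicator U x)" by blast
  qed
qed

section \<open>Mixtures of measures with Fourier decay\<close>

context
  fixes p :: "'i pmf" and \<nu> :: "'i \<Rightarrow> (real ^ 'd) measure"
  assumes \<nu>: "\<And>i. \<nu> i \<in> borel_probs"
begin

text \<open>The sigma-algebra of a \<open>pmf\<close> is discrete, so any family of probability
  measures is a kernel. One construction thus serves both two-point and countable mixtures.\<close>

lemma mixture_kernel: "\<nu> \<in> measure_pmf p \<rightarrow>\<^sub>M subprob_algebra borel"
  using borel_probsD[OF \<nu>] by (auto simp: space_subprob_algebra intro!: prob_space_imp_subprob_space)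

lemma mixture_in_borel_probs: "measure_pmf p \<bind> \<nu> \<in> borel_probs"
proof -
  have "prob_space (measure_pmf p \<bind> \<nu>)"
    using borel_probsD[OF \<nu>] by (intro measure_pmf.prob_space_bind[OF _ mixture_kernel]) auto
  moreover have "sets (measure_pmf p \<bind> \<nu>) = sets borel"
    using borel_probsD[OF \<nu>] by (intro sets_bind) auto
  ultimately show ?thesis by (simp add: borel_probs_def)
qed

lemma emeasure_mixture:
  assumes "A \<in> sets borel"
  shows "emeasure (measure_pmf p \<bind> \<nu>) A = (\<integral>\<^sup>+i. emeasure (\<nu> i) A \<partial>measure_pmf p)"
  using assms by (intro emeasure_bind[OF _ mixture_kernel]) auto

lemma integral_mixture:
  fixes f :: "real ^ 'd \<Rightarrow> real"
  assumes "f \<in> borel_measurable borel" "\<And>x. \<bar>f x\<bar> \<le> B"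
  shows "integral\<^sup>L (measure_pmf p \<bind> \<nu>) f = (LINT i|measure_pmf p. integral\<^sup>L (\<nu> i) f)"
proof (rule integral_bind[OF assms(1)])
  show "AE i in measure_pmf p. emeasure (\<nu> i) (space (\<nu> i)) \<le> ennreal 1"
    using borel_probsD(1)[OF \<nu>] by (auto simp: prob_space.emeasure_space_1)
qed (use assms mixture_kernel measure_pmf.finite_measure in auto)

text \<open>The exchange of integrals is available for bounded real functions, so real and imaginary
  parts of the character are treated separately.\<close>

lemma fourier_transform_mixture:
  "fourier_transform (measure_pmf p \<bind> \<nu>) \<xi> = (LINT i|measure_pmf p. fourier_transform (\<nu> i) \<xi>)"
proof -
  have 1: "integrable M (fourier_character \<xi>)" if "M \<in> borel_probs" for M :: "(real ^ 'd) measure"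
    using borel_probsD[OF that]
    by (intro integrable_fourier_character) (auto intro: prob_space.finite_measure)
  have bnd: "\<bar>Re (fourier_character \<xi> x)\<bar> \<le> 1" "\<bar>Im (fourier_character \<xi> x)\<bar> \<le> 1" for x
    by (metis norm_fourier_character abs_Re_le_cmod, metis norm_fourier_character abs_Im_le_cmod)
  have 2: "integrable (measure_pmf p) (\<lambda>i. fourier_transform (\<nu> i) \<xi>)"
    using norm_fourier_transform_le_1[OF \<nu>] by (intro measure_pmf.integrable_const_bound[where B = 1]) auto
  have "Re (fourier_transform (measure_pmf p \<bind> \<nu>) \<xi>) = Re (LINT i|measure_pmf p. fourier_transform (\<nu> i) \<xi>)"
    using integral_mixture[of "\<lambda>x. Re (fourier_character \<xi> x)" 1, OF _ bnd(1)]
    by (simp add: integral_Re[OF 2[unfolded fourier_transform_eq], symmetric] fourier_transform_eq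
        integral_Re[OF 1[OF \<nu>], symmetric] integral_Re[OF 1[OF mixture_in_borel_probs], symmetric])
  moreover have "Im (fourier_transform (measure_pmf p \<bind> \<nu>) \<xi>) = Im (LINT i|measure_pmf p. fourier_transform (\<nu> i) \<xi>)"
    using integral_mixture[of "\<lambda>x. Im (fourier_character \<xi> x)" 1, OF _ bnd(2)]
    by (simp add: integral_Im[OF 2[unfolded fourier_transform_eq], symmetric] fourier_transform_eq
        integral_Im[OF 1[OF \<nu>], symmetric] integral_Im[OF 1[OF mixture_in_borel_probs], symmetric])
  ultimately show ?thesis by (rule complex_eqI)
qed

end

lemma decay_bounded_nonneg:
  assumes "\<nu> \<in> decay_bounded r K"
  shows "0 \<le> K"
proof -
  have "norm (fourier_transform \<nu> 0) \<le> K * (1 + norm (0::real^'a)) powr - r"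
    using assms unfolding decay_bounded_def by blast
  then have "norm (fourier_transform \<nu> 0) \<le> K" by simp
  then show ?thesis using norm_ge_zero order_trans by blast
qed

lemma decay_bounded_mono: "K \<le> L \<Longrightarrow> decay_bounded r K \<subseteq> decay_bounded r L"
  unfolding decay_bounded_def by (auto intro: order_trans[OF _ mult_right_mono])

lemma mixture_in_decay_bounded:
  fixes \<nu> :: "'i \<Rightarrow> (real ^ 'd) measure"
  assumes \<nu>: "\<And>i. \<nu> i \<in> decay_bounded r (K i)" and K: "integrable (measure_pmf p) K"
  shows "measure_pmf p \<bind> \<nu> \<in> decay_bounded r (LINT i|measure_pmf p. K i)"
proof -
  have \<nu>': "\<nu> i \<in> borel_probs" for i using \<nu> by (simp add: decay_bounded_def)
  have "norm (fourier_transform (measure_pmf p \<bind> \<nu>) \<xi>) \<le> (LINT i|measure_pmf p. K i) * (1 + norm \<xi>) powr - r" for \<xi>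
  proof -
    have "norm (fourier_transform (measure_pmf p \<bind> \<nu>) \<xi>) \<le> (LINT i|measure_pmf p. norm (fourier_transform (\<nu> i) \<xi>))"
      unfolding fourier_transform_mixture[of \<nu>, OF \<nu>'] by (rule integral_norm_bound)
    also have "\<dots> \<le> (LINT i|measure_pmf p. K i * (1 + norm \<xi>) powr - r)"
      using \<nu> K by (intro integral_mono') (auto simp: decay_bounded_def decay_bounded_nonneg[OF \<nu>])
    finally show ?thesis by simp
  qed
  then show ?thesis using mixture_in_borel_probs[of \<nu>, OF \<nu>'] by (simp add: decay_bounded_def)
qed

text \<open>A Bernoulli mixture of the two measures. The conclusion speaks of integrals because
  minimax sees a measure only through its values on test functions.\<close>

lemma decay_bounded_convex:
  fixes \<nu>\<^sub>1 \<nu>\<^sub>2 :: "(real ^ 'd) measure"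
  assumes "\<nu>\<^sub>1 \<in> decay_bounded r K" "\<nu>\<^sub>2 \<in> decay_bounded r K" "0 \<le> t" "t \<le> 1"
  shows "\<exists>\<nu>\<in>decay_bounded r K. \<forall>f B. f \<in> borel_measurable borel \<longrightarrow> (\<forall>x. \<bar>f x\<bar> \<le> B) \<longrightarrow>
    integral\<^sup>L \<nu> f = t * integral\<^sup>L \<nu>\<^sub>1 f + (1 - t) * (integral\<^sup>L \<nu>\<^sub>2 f :: real)"
proof -
  define \<nu> where "\<nu> b = (if b then \<nu>\<^sub>1 else \<nu>\<^sub>2)" for b
  have \<nu>: "\<nu> b \<in> decay_bounded r K" for b using assms by (simp add: \<nu>_def)
  then have \<nu>': "\<nu> b \<in> borel_probs" for b by (simp add: decay_bounded_def)
  have "measure_pmf (bernoulli_pmf t) \<bind> \<nu> \<in> decay_bounded r (LINT b|measure_pmf (bernoulli_pmf t). K)"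
    by (rule mixture_in_decay_bounded[OF \<nu>]) simp
  moreover have "integral\<^sup>L (measure_pmf (bernoulli_pmf t) \<bind> \<nu>) f
      = t * integral\<^sup>L \<nu>\<^sub>1 f + (1 - t) * (integral\<^sup>L \<nu>\<^sub>2 f :: real)"
    if "f \<in> borel_measurable borel" "\<forall>x. \<bar>f x\<bar> \<le> B" for f B
    using integral_mixture[of \<nu> f B, OF \<nu>'] that assms by (simp add: \<nu>_def)
  ultimately show ?thesis by (intro bexI[of _ "measure_pmf (bernoulli_pmf t) \<bind> \<nu>"]) auto
qed

text \<open>Weights proportional to 2^(-n) / (1 + |K n|): the denominator cancels the growth of
  \<open>K\<close>, and no weight vanishes.\<close>

lemma exists_integrating_pmf:
  fixes K :: "nat \<Rightarrow> real"
  obtains p :: "nat pmf" where "integrable (measure_pmf p) K" "\<And>n. 0 < pmf p n"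
proof -
  define w where "w n = (1/2) ^ n / (1 + \<bar>K n\<bar>)" for n
  have w_pos: "0 < w n" for n by (simp add: w_def add_pos_nonneg)
  have w_le: "w n \<le> (1/2) ^ n" "w n * \<bar>K n\<bar> \<le> (1/2) ^ n" for n
    by (simp_all add: w_def field_simps add_pos_nonneg)
  have geo: "summable (\<lambda>n. (1/2 :: real) ^ n)" by (intro summable_geometric) simp
  have w: "summable w"
    by (rule summable_comparison_test'[OF geo]) (use w_pos w_le in \<open>simp add: less_imp_le\<close>)
  define W where "W = suminf w"
  have W: "0 < W" unfolding W_def using w w_pos by (intro suminf_pos) auto
  have sums: "(\<lambda>n. w n / W) sums 1"
    using sums_divide[OF summable_sums[OF w], of W] W by (simp add: W_def)
  have "(\<integral>\<^sup>+n. ennreal (w n / W) \<partial>count_space UNIV) = 1"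
    using w_pos W sums_unique[OF sums, symmetric]
    by (subst nn_integral_count_space_nat) (simp add: suminf_ennreal_eq[OF _ sums] less_imp_le)
  then have p: "pmf (embed_pmf (\<lambda>n. w n / W)) n = w n / W" for n
    using w_pos W by (intro pmf_embed_pmf) (auto simp: less_imp_le)
  show thesis
  proof
    show "0 < pmf (embed_pmf (\<lambda>n. w n / W)) n" for n using p w_pos W by simp
    have "summable (\<lambda>n. norm (pmf (embed_pmf (\<lambda>n. w n / W)) n *\<^sub>R K n))"
    proof (rule summable_comparison_test'[OF summable_divide[OF geo, of W]])
      show "norm (norm (pmf (embed_pmf (\<lambda>n. w n / W)) n *\<^sub>R K n)) \<le> (1/2) ^ n / W" if "0 \<le> n" for n
        using w_le(2)[of n] w_pos[of n] W by (simp add: p abs_mult field_simps)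
    qed
    then show "integrable (measure_pmf (embed_pmf (\<lambda>n. w n / W))) K"
      unfolding measure_pmf_eq_density
      by (subst integrable_density) (auto simp: integrable_count_space_nat_iff)
  qed
qed

text \<open>The constants \<open>K n\<close> may be unbounded, so the mixing weights must make them
  integrable. Positivity of the weights makes a null set of the mixture null for every
  component.\<close>

lemma countable_domination:
  fixes \<nu> :: "nat \<Rightarrow> (real ^ 'd) measure"
  assumes \<nu>: "\<And>n. \<nu> n \<in> decay_bounded r (K n)"
  obtains \<nu>' K' where "\<nu>' \<in> decay_bounded r K'" "\<And>n. absolutely_continuous \<nu>' (\<nu> n)"
proof -
  obtain p where p: "integrable (measure_pmf p) K" "\<And>n. 0 < pmf p n"
    using exists_integrating_pmf by blast
  have \<nu>': "\<nu> n \<in> borel_probs" for n using \<nu> by (simp add: decay_bounded_def)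
  show thesis
  proof
    show "measure_pmf p \<bind> \<nu> \<in> decay_bounded r (LINT i|measure_pmf p. K i)"
      by (rule mixture_in_decay_bounded[OF \<nu> p(1)])
    have "emeasure (\<nu> n) A = 0" if A: "A \<in> sets borel" "emeasure (measure_pmf p \<bind> \<nu>) A = 0" for n A
    proof -
      have "AE i in measure_pmf p. emeasure (\<nu> i) A = 0"
        using A by (simp add: emeasure_mixture[of \<nu>, OF \<nu>'] nn_integral_0_iff_AE)
      then show ?thesis using p(2)[of n] by (simp add: AE_measure_pmf_iff set_pmf_iff)
    qed
    then show "absolutely_continuous (measure_pmf p \<bind> \<nu>) (\<nu> n)" for n
      using borel_probsD(2)[OF mixture_in_borel_probs[of \<nu>, OF \<nu>']] borel_probsD(2)[OF \<nu>']
      by (auto simp: absolutely_continuous_def null_sets_def)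
  qed
qed

text \<open>Characters are bounded and continuous, so the transforms converge pointwise and the
  bound with its fixed K survives.\<close>

lemma decay_bounded_limit:
  assumes \<nu>: "\<And>n. \<nu> n \<in> decay_bounded r K" and "\<tau> \<in> borel_probs"
    and lim: "\<And>(f :: real ^ 'd \<Rightarrow> complex) B. continuous_on UNIV f \<Longrightarrow> (\<And>x. norm (f x) \<le> B) \<Longrightarrow>
       (\<lambda>n. integral\<^sup>L (\<nu> n) f) \<longlonglongrightarrow> integral\<^sup>L \<tau> f"
  shows "\<tau> \<in> decay_bounded r K"
proof -
  have "norm (fourier_transform \<tau> \<xi>) \<le> K * (1 + norm \<xi>) powr - r" for \<xi>
  proof (rule LIMSEQ_le_const2)
    show "(\<lambda>n. norm (fourier_transform (\<nu> n) \<xi>)) \<longlonglongrightarrow> norm (fourier_transform \<tau> \<xi>)"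
      unfolding fourier_transform_eq
      by (intro tendsto_norm lim[where B = 1] continuous_fourier_character) (simp add: norm_fourier_character)
    show "\<exists>N. \<forall>n\<ge>N. norm (fourier_transform (\<nu> n) \<xi>) \<le> K * (1 + norm \<xi>) powr - r"
      using \<nu> by (auto simp: decay_bounded_def)
  qed
  then show ?thesis using assms(2) by (simp add: decay_bounded_def)
qed

text \<open>The two weights differ only near the origin, where the transform of a probability
  measure is at most 1 anyway. This links the definition in the theorem to the classes with explicit
  constants.\<close>

lemma fourier_decay_iff:
  fixes \<nu> :: "(real ^ 'd) measure"
  assumes \<nu>: "\<nu> \<in> borel_probs" and "0 \<le> s"
  shows "fourier_decay \<nu> s \<longleftrightarrow> (\<exists>K. \<nu> \<in> decay_bounded (s / 2) K)"
proof
  assume "\<exists>K. \<nu> \<in> decay_bounded (s / 2) K"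
  then obtain K where K: "\<nu> \<in> decay_bounded (s / 2) K" by blast
  have "norm (fourier_transform \<nu> \<xi>) \<le> K * norm \<xi> powr (- s / 2)" if "\<xi> \<noteq> 0" for \<xi>
  proof -
    have "norm (fourier_transform \<nu> \<xi>) \<le> K * (1 + norm \<xi>) powr - (s / 2)"
      using K by (simp add: decay_bounded_def)
    also have "\<dots> \<le> K * norm \<xi> powr - (s / 2)"
      using decay_bounded_nonneg[OF K] that \<open>0 \<le> s\<close> by (intro mult_left_mono powr_mono2') auto
    finally show ?thesis by simp
  qed
  then show "fourier_decay \<nu> s" by (auto simp: fourier_decay_def)
next
  assume "fourier_decay \<nu> s"
  then obtain C where C: "\<And>\<xi>. \<xi> \<noteq> 0 \<Longrightarrow> norm (fourier_transform \<nu> \<xi>) \<le> C * norm \<xi> powr (- s / 2)"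
    by (auto simp: fourier_decay_def)
  \<comment> \<open>The maximum serves both regions. The power of 2 pays for 1 + |\<xi>| \<le> 2 in
    the unit ball and for |\<xi>| \<ge> (1 + |\<xi>|)/2 outside it.\<close>
  let ?K = "max 1 C * 2 powr (s / 2)"
  have "norm (fourier_transform \<nu> \<xi>) \<le> ?K * (1 + norm \<xi>) powr - (s / 2)" for \<xi>
  proof (cases "norm \<xi> \<le> 1")
    case True
    have "norm (fourier_transform \<nu> \<xi>) \<le> 1 * (2 powr (s / 2) * 2 powr - (s / 2))"
      using norm_fourier_transform_le_1[OF \<nu>] by (simp flip: powr_add)
    also have "\<dots> \<le> max 1 C * (2 powr (s / 2) * (1 + norm \<xi>) powr - (s / 2))"
      using True \<open>0 \<le> s\<close>
      by (intro mult_mono[OF _ mult_left_mono[OF powr_mono2']]) (auto simp: add_pos_nonneg)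
    finally show ?thesis by (simp add: mult.assoc)
  next
    case False
    then have "norm (fourier_transform \<nu> \<xi>) \<le> C * norm \<xi> powr - (s / 2)" using C[of \<xi>] by force
    also have "\<dots> \<le> max 1 C * ((1 + norm \<xi>) / 2) powr - (s / 2)"
      using False \<open>0 \<le> s\<close> by (intro mult_mono powr_mono2') auto
    also have "((1 + norm \<xi>) / 2) powr - (s / 2) = 2 powr (s / 2) * (1 + norm \<xi>) powr - (s / 2)"
      by (simp add: powr_divide powr_minus field_simps)
    finally show ?thesis by (simp add: mult.assoc)
  qed
  then show "\<exists>K. \<nu> \<in> decay_bounded (s / 2) K" using \<nu> by (auto simp: decay_bounded_def)
qed

section \<open>A common null set\<close>

text \<open>Only decay at infinity matters, so exp u \<ge> 1 + u together with 2|x| \<le> 1 + |x|^2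
  suffices.\<close>

lemma gaussian_weight_le: "x \<noteq> 0 \<Longrightarrow> gaussian_weight x \<le> 1 / norm x"
proof -
  assume "x \<noteq> 0"
  have "1 \<le> 2 * pi\<^sup>2" using pi_ge_two by (simp add: power2_eq_square mult_ge1_I)
  then have "(norm x)\<^sup>2 \<le> 2 * pi\<^sup>2 * (norm x)\<^sup>2"
    using mult_right_mono[of 1 "2 * pi\<^sup>2" "(norm x)\<^sup>2"] by simp
  moreover have "0 \<le> (norm x - 1)\<^sup>2" by simp
  moreover have "2 * norm x = 1 + (norm x)\<^sup>2 - (norm x - 1)\<^sup>2" by (simp add: power2_eq_square algebra_simps)
  ultimately have "norm x \<le> 1 + 2 * pi\<^sup>2 * (norm x)\<^sup>2" using norm_ge_zero[of x] by linarith
  also have "\<dots> \<le> exp (2 * pi\<^sup>2 * (norm x)\<^sup>2)" by (rule exp_ge_add_one_self)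
  finally have "1 / exp (2 * pi\<^sup>2 * (norm x)\<^sup>2) \<le> 1 / norm x"
    using \<open>x \<noteq> 0\<close> by (intro divide_left_mono) auto
  then show ?thesis by (simp add: gaussian_weight_def exp_minus inverse_eq_divide)
qed

text \<open>The bound depends on \<nu> only through \<open>m\<close>, so a common lower bound on the
  weighted masses makes the damped measures uniformly tight.\<close>

lemma damped_tail:
  assumes \<nu>: "\<nu> \<in> borel_probs" and "0 < m" "0 < R"
  shows "measure (density \<nu> (\<lambda>x. ennreal (1 / m * gaussian_weight x))) {x. R < norm x} \<le> 1 / (m * R)"
proof -
  interpret prob_space \<nu> using borel_probsD[OF \<nu>] by simp
  have [measurable_cong]: "sets \<nu> = sets borel" using borel_probsD[OF \<nu>] by simp
  have "emeasure (density \<nu> (\<lambda>x. ennreal (1 / m * gaussian_weight x))) {x. R < norm x}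
      = (\<integral>\<^sup>+x. ennreal (1 / m * gaussian_weight x) * indicator {x. R < norm x} x \<partial>\<nu>)"
    by (rule emeasure_density) measurable
  also have "\<dots> \<le> (\<integral>\<^sup>+x. ennreal (1 / (m * R)) \<partial>\<nu>)"
  proof (rule nn_integral_mono)
    fix x
    have "1 / m * gaussian_weight x \<le> 1 / m * (1 / R)" if "R < norm x"
    proof (rule mult_left_mono)
      have "gaussian_weight x \<le> 1 / norm x" using that \<open>0 < R\<close> by (intro gaussian_weight_le) auto
      also have "\<dots> \<le> 1 / R" using that \<open>0 < R\<close> by (simp add: frac_le)
      finally show "gaussian_weight x \<le> 1 / R" .
    qed (use \<open>0 < m\<close> in simp)
    then show "ennreal (1 / m * gaussian_weight x) * indicator {x. R < norm x} x \<le> ennreal (1 / (m * R))"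
      by (auto simp: indicator_def intro!: ennreal_leI)
  qed
  also have "\<dots> = ennreal (1 / (m * R))" by (simp add: emeasure_space_1)
  finally show ?thesis using \<open>0 < m\<close> \<open>0 < R\<close> by (simp add: measure_def enn2real_leI)
qed

abbreviation continuous_unit_functions :: "('a::topological_space \<Rightarrow> real) set" where
  "continuous_unit_functions \<equiv> {f. continuous_on UNIV f \<and> (\<forall>x. f x \<in> {0..1})}"

lemma unit_function_integrable:
  fixes f :: "'a::topological_space \<Rightarrow> real"
  assumes "f \<in> continuous_unit_functions" "finite_measure M" "sets M = sets borel"
  shows "integrable M f"
proof -
  interpret finite_measure M by fact
  have [measurable_cong]: "sets M = sets borel" by fact
  have [measurable]: "f \<in> borel_measurable borel"
    using assms by (auto intro: borel_measurable_continuous_onI)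
  show ?thesis using assms by (intro integrable_const_bound[where B = 1]) auto
qed

text \<open>The payoff of the minimax: it is small when f is nearly 0 for the weighted \<nu> and
  nearly 1 for \<mu>. It is affine in both \<nu> and f.\<close>

definition separation :: "(real ^ 'd) measure \<Rightarrow> (real ^ 'd) measure \<Rightarrow> (real ^ 'd \<Rightarrow> real) \<Rightarrow> real" where
  "separation \<mu> \<nu> f = (LINT x|\<nu>. f x * gaussian_weight x) + (LINT x|\<mu>. 1 - f x)"

context
  fixes \<mu> :: "(real ^ 'd) measure" and r :: real
  assumes \<mu>: "finite_measure \<mu>" "sets \<mu> = sets borel"
    and r: "0 \<le> r"
    and singular: "\<And>\<nu> K. \<nu> \<in> decay_bounded r K \<Longrightarrow>
      \<exists>E\<in>sets borel. emeasure \<nu> E = 0 \<and> emeasure \<mu> (- E) = 0"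
begin

interpretation \<mu>: finite_measure \<mu> by (rule \<mu>)

lemma space_\<mu>: "space \<mu> = UNIV"
  using sets_eq_imp_space_eq[OF \<mu>(2)] by simp

text \<open>Outer regularity encloses the \<tau>-null carrier of \<mu> in an open set of small
  \<tau>-measure. Test functions below its indicator keep the \<tau>-integral small, while dominated
  convergence makes the \<mu>-term vanish.\<close>

lemma singular_test_function:
  assumes \<tau>: "\<tau> \<in> decay_bounded r K" and "0 < e"
    and \<Phi>: "\<And>f. f \<in> \<Phi> \<Longrightarrow> f \<in> continuous_unit_functions"
      "\<And>U. open U \<Longrightarrow> \<exists>f. range f \<subseteq> \<Phi> \<and> (\<forall>n x. f n x \<le> indicator U x) \<and>
      (\<forall>x. (\<lambda>n::nat. f n x) \<longlonglongrightarrow> indicator U x)"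
  shows "\<exists>f\<in>\<Phi>. integral\<^sup>L \<tau> f + (LINT x|\<mu>. 1 - f x) < e"
proof -
  have \<tau>': "\<tau> \<in> borel_probs" using \<tau> by (simp add: decay_bounded_def)
  interpret \<tau>: prob_space \<tau> using borel_probsD[OF \<tau>'] by simp
  have [measurable_cong]: "sets \<tau> = sets borel" "sets \<mu> = sets borel"
    using borel_probsD[OF \<tau>'] \<mu> by auto
  obtain E where E: "E \<in> sets borel" "emeasure \<tau> E = 0" "emeasure \<mu> (- E) = 0"
    using singular[OF \<tau>] by blast
  have "(INF U \<in> {U. E \<subseteq> U \<and> open U}. emeasure \<tau> U) < ennreal (e / 2)"
    using outer_regular[of \<tau> E] E \<open>0 < e\<close> borel_probsD[OF \<tau>'] by (simp add: \<tau>.emeasure_space_1)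
  then obtain U where U: "E \<subseteq> U" "open U" "emeasure \<tau> U < ennreal (e / 2)"
    by (auto simp: INF_less_iff)
  have [measurable]: "U \<in> sets borel" using U by auto
  have \<mu>U: "AE x in \<mu>. x \<in> U"
    using E U by (intro AE_I[of _ _ "- E"]) auto
  obtain f where f: "\<And>n. f n \<in> \<Phi>" "\<And>n x. f n x \<le> indicator U x"
    "\<And>x. (\<lambda>n::nat. f n x) \<longlonglongrightarrow> indicator U x"
    using \<Phi>(2)[OF U(2)] by blast
  have f01: "0 \<le> f n x" "f n x \<le> 1" for n x using \<Phi>(1)[OF f(1)[of n]] by auto
  have [measurable]: "f n \<in> borel_measurable borel" for n
    using \<Phi>(1)[OF f(1)[of n]] by (auto intro: borel_measurable_continuous_onI)
  have "(\<lambda>n. LINT x|\<mu>. 1 - f n x) \<longlonglongrightarrow> (LINT x|\<mu>. 0)"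
  proof (rule integral_dominated_convergence[where w = "\<lambda>_. 1"])
    show "AE x in \<mu>. (\<lambda>n. 1 - f n x) \<longlonglongrightarrow> 0"
      using \<mu>U
    proof eventually_elim
      case (elim x)
      then have "(\<lambda>n. 1 - f n x) \<longlonglongrightarrow> 1 - 1"
        using f(3)[of x] by (intro tendsto_diff tendsto_const) simp
      then show ?case by simp
    qed
    show "AE x in \<mu>. norm (1 - f n x) \<le> 1" for n using f01[of n] by (intro AE_I2) auto
  qed auto
  then have "\<forall>\<^sub>F n in sequentially. (LINT x|\<mu>. 1 - f n x) < e / 2"
    using \<open>0 < e\<close> by (intro order_tendstoD) auto
  then obtain n where n: "(LINT x|\<mu>. 1 - f n x) < e / 2"
    by (auto simp: eventually_sequentially)
  have "integral\<^sup>L \<tau> (f n) \<le> integral\<^sup>L \<tau> (indicator U)"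
    using f(2) f01 by (intro integral_mono') (auto simp: \<tau>.emeasure_eq_measure less_top[symmetric])
  also have "\<dots> < e / 2" using U(3) \<open>0 < e\<close> by (simp add: \<tau>.emeasure_eq_measure ennreal_less_iff borel_probsD[OF \<tau>'])
  finally show ?thesis using n f(1)[of n] by (intro bexI[of _ "f n"]) auto
qed

text \<open>
  By minimax a failure for every \<open>f\<close> is witnessed, for each finite set of test functions, by a single
  measure. The damped witnesses accumulate at a measure that still has decay
  but is not singular to \<open>\<mu>\<close>.
\<close>

lemma exists_separating_function:
  assumes "0 < e"
  shows "\<exists>f\<in>continuous_unit_functions. \<forall>\<nu>\<in>decay_bounded r K. separation \<mu> \<nu> f \<le> e"
proof (rule ccontr)
  let ?F = "continuous_unit_functions :: (real ^ 'd \<Rightarrow> real) set"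
  assume "\<not> (\<exists>f\<in>?F. \<forall>\<nu>\<in>decay_bounded r K. separation \<mu> \<nu> f \<le> e)"
  then have ex: "\<exists>\<nu>\<in>decay_bounded r K. e < separation \<mu> \<nu> f" if "f \<in> ?F" for f
    using that by (meson not_le)
  have one: "(\<lambda>_. 1) \<in> ?F" by auto
  have int\<mu>: "integrable \<mu> f" if "f \<in> ?F" for f
    using unit_function_integrable[OF that] \<mu> by blast
  have int\<nu>: "integrable \<nu> (\<lambda>x. f x * gaussian_weight x)" if "\<nu> \<in> decay_bounded r K" "f \<in> ?F" for \<nu> f
  proof (rule unit_function_integrable)
    show "(\<lambda>x. f x * gaussian_weight x) \<in> ?F"
      using that(2) gaussian_weight_bounds
      by (auto intro!: continuous_intros continuous_gaussian_weight mult_nonneg_nonneg mult_le_one less_imp_le[OF gaussian_weight_bounds(1)])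
    have "\<nu> \<in> borel_probs" using that(1) by (simp add: decay_bounded_def)
    from borel_probsD(1,2)[OF this] show "finite_measure \<nu>" "sets \<nu> = sets borel"
      by (simp_all add: prob_space_def)
  qed
  let ?V = "separation \<mu> ` decay_bounded r K"
  have minimax: "\<exists>\<nu>\<in>decay_bounded r K. \<forall>f\<in>G. e < separation \<mu> \<nu> f" if G: "finite G" "G \<subseteq> ?F" for G
  proof -
    have "\<exists>v\<in>?V. \<forall>f\<in>G. e < v f"
    proof (rule minimax_finite[OF G])
      show "?V \<noteq> {}" using ex[OF one] by blast
      show "\<exists>w\<in>?V. \<forall>f\<in>?F. w f = t * u f + (1 - t) * v f"
        if "u \<in> ?V" "v \<in> ?V" and t: "0 \<le> t" "t \<le> 1" for u v t
      proof -
        obtain \<nu>\<^sub>1 \<nu>\<^sub>2 where \<nu>: "\<nu>\<^sub>1 \<in> decay_bounded r K" "\<nu>\<^sub>2 \<in> decay_bounded r K"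
          "u = separation \<mu> \<nu>\<^sub>1" "v = separation \<mu> \<nu>\<^sub>2"
          using \<open>u \<in> ?V\<close> \<open>v \<in> ?V\<close> by blast
        obtain \<nu> where \<nu>': "\<nu> \<in> decay_bounded r K"
          "\<And>f B. f \<in> borel_measurable borel \<Longrightarrow> (\<And>x. \<bar>f x\<bar> \<le> B) \<Longrightarrow>
            integral\<^sup>L \<nu> f = t * integral\<^sup>L \<nu>\<^sub>1 f + (1 - t) * (integral\<^sup>L \<nu>\<^sub>2 f :: real)"
          using decay_bounded_convex[OF \<nu>(1,2) t] by metis
        have "separation \<mu> \<nu> f = t * u f + (1 - t) * v f" if f: "f \<in> ?F" for f
        proof -
          have [measurable]: "f \<in> borel_measurable borel"
            using f by (auto intro: borel_measurable_continuous_onI)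
          have "\<bar>f x * gaussian_weight x\<bar> \<le> 1" for x
            using f gaussian_weight_bounds[of x] by (auto simp: abs_mult intro!: mult_le_one)
          then show ?thesis
            using \<nu>'(2)[of "\<lambda>x. f x * gaussian_weight x" 1] by (simp add: separation_def \<nu> algebra_simps)
        qed
        then show ?thesis using \<nu>'(1) by blast
      qed
      show "(\<lambda>x. t * f x + (1 - t) * g x) \<in> ?F"
        if "f \<in> ?F" "g \<in> ?F" "0 \<le> t" "t \<le> 1" for f g t
        using that by (auto intro!: continuous_intros convex_bound_le)
      show "v (\<lambda>x. t * f x + (1 - t) * g x) = t * v f + (1 - t) * v g"
        if v: "v \<in> ?V" and fg: "f \<in> ?F" "g \<in> ?F" and t: "0 \<le> t" "t \<le> 1" for v f g t
      proof -
        obtain \<nu> where \<nu>: "\<nu> \<in> decay_bounded r K" "v = separation \<mu> \<nu>" using v by blast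
        have "(LINT x|\<nu>. (t * f x + (1 - t) * g x) * gaussian_weight x)
            = t * (LINT x|\<nu>. f x * gaussian_weight x) + (1 - t) * (LINT x|\<nu>. g x * gaussian_weight x)"
          using int\<nu>[OF \<nu>(1) fg(1)] int\<nu>[OF \<nu>(1) fg(2)] by (simp add: distrib_right mult.assoc)
        moreover have "(LINT x|\<mu>. 1 - (t * f x + (1 - t) * g x))
            = t * (LINT x|\<mu>. 1 - f x) + (1 - t) * (LINT x|\<mu>. 1 - g x)"
          using int\<mu>[OF fg(1)] int\<mu>[OF fg(2)] by (simp add: algebra_simps)
        ultimately show ?thesis by (simp add: \<nu> separation_def algebra_simps)
      qed
      show "\<exists>v\<in>?V. e < v f" if "f \<in> ?F" for f using ex[OF that] by blast
    qed
    then show ?thesis by blast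
  qed
  obtain \<Phi> :: "(real ^ 'd \<Rightarrow> real) set" where \<Phi>: "countable \<Phi>" "\<And>f. f \<in> \<Phi> \<Longrightarrow> f \<in> ?F"
    "\<And>U. open U \<Longrightarrow> \<exists>f. range f \<subseteq> \<Phi> \<and> (\<forall>n x. f n x \<le> indicator U x) \<and>
      (\<forall>x. (\<lambda>n::nat. f n x) \<longlonglongrightarrow> indicator U x)"
    by (rule countable_test_functions[where 'a = "real ^ 'd"]) blast
  \<comment> \<open>The constant 1 is always included: its \<mu>-term is zero, so its separation is
    exactly the weighted mass, which is thereby kept above e.\<close>
  have "\<exists>\<nu>\<in>decay_bounded r K. \<forall>f\<in>insert (\<lambda>_. 1) {f\<in>\<Phi>. to_nat_on \<Phi> f \<le> k}. e < separation \<mu> \<nu> f" for k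
  proof (rule minimax)
    have "inj_on (to_nat_on \<Phi>) {f\<in>\<Phi>. to_nat_on \<Phi> f \<le> k}"
      by (rule inj_on_subset[OF inj_on_to_nat_on[OF \<Phi>(1)]]) auto
    moreover have "to_nat_on \<Phi> ` {f\<in>\<Phi>. to_nat_on \<Phi> f \<le> k} \<subseteq> {..k}" by auto
    ultimately have "finite {f\<in>\<Phi>. to_nat_on \<Phi> f \<le> k}" by (metis finite_imageD finite_atMost finite_subset)
    then show "finite (insert (\<lambda>_. 1) {f\<in>\<Phi>. to_nat_on \<Phi> f \<le> k})" by simp
    show "insert (\<lambda>_. 1) {f\<in>\<Phi>. to_nat_on \<Phi> f \<le> k} \<subseteq> ?F" using \<Phi>(2) one by auto
  qed
  then obtain \<nu> where \<nu>: "\<And>k. \<nu> k \<in> decay_bounded r K"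
    and sep_one: "\<And>k. e < separation \<mu> (\<nu> k) (\<lambda>_. 1)"
    and sep: "\<And>k f. f \<in> \<Phi> \<Longrightarrow> to_nat_on \<Phi> f \<le> k \<Longrightarrow> e < separation \<mu> (\<nu> k) f"
    by (auto simp: ball_simps) metis
  have \<nu>': "\<nu> k \<in> borel_probs" for k using \<nu> by (simp add: decay_bounded_def)
  define m where "m k = (LINT x|\<nu> k. gaussian_weight x)" for k
  have m: "e < m k" for k using sep_one[of k] by (simp add: separation_def m_def)
  have m_pos: "0 < m k" for k using m[of k] \<open>0 < e\<close> by simp
  have m_le: "m k \<le> 1" for k
  proof -
    interpret prob_space "\<nu> k" using borel_probsD[OF \<nu>'] by simp
    have "m k \<le> (LINT x|\<nu> k. 1)"
      unfolding m_def using gaussian_weight_bounds by (intro integral_mono') auto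
    then show ?thesis by (simp add: prob_space)
  qed
  define \<rho> where "\<rho> k = density (\<nu> k) (\<lambda>x. ennreal (1 / m k * gaussian_weight x))" for k
  define L where "L = K * gaussian_moment TYPE('d) r / e"
  have \<rho>: "\<rho> k \<in> decay_bounded r L" for k
  proof -
    have "0 \<le> K" using decay_bounded_nonneg[OF \<nu>[of k]] .
    moreover have "0 \<le> gaussian_moment TYPE('d) r"
      unfolding gaussian_moment_def by (intro integral_nonneg_AE) auto
    ultimately have "K * gaussian_moment TYPE('d) r / m k \<le> L"
      unfolding L_def using m[of k] \<open>0 < e\<close> by (intro divide_left_mono) auto
    then show ?thesis
      using decay_bounded_damped[OF \<nu> r m_pos, OF m_def[symmetric]] decay_bounded_mono
      unfolding \<rho>_def by blast
  qed
  have \<rho>': "\<rho> k \<in> borel_probs" for k using \<rho> by (simp add: decay_bounded_def)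
  have tight: "\<exists>R. \<forall>k. measure (\<rho> k) {x. R < norm x} \<le> d" if "0 < d" for d
  proof (intro exI allI)
    fix k
    \<comment> \<open>The radius 1/(e d) turns the tail bound into (e d)/m, which is below d because
      m exceeds e.\<close>
    have "measure (\<rho> k) {x. 1 / (e * d) < norm x} \<le> 1 / (m k * (1 / (e * d)))"
      unfolding \<rho>_def using \<open>0 < d\<close> \<open>0 < e\<close> by (intro damped_tail \<nu>' m_pos) auto
    also have "\<dots> \<le> d" using m[of k] \<open>0 < d\<close> \<open>0 < e\<close> by (simp add: field_simps)
    finally show "measure (\<rho> k) {x. 1 / (e * d) < norm x} \<le> d" .
  qed
  obtain q \<tau> where q: "strict_mono q" and "\<tau> \<in> borel_probs"
    and lim: "\<And>(f :: real ^ 'd \<Rightarrow> complex) B. continuous_on UNIV f \<Longrightarrow> (\<And>x. norm (f x) \<le> B) \<Longrightarrow>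
       (\<lambda>n. integral\<^sup>L (\<rho> (q n)) f) \<longlonglongrightarrow> integral\<^sup>L \<tau> f"
    using tight_imp_convergent_subsequence[of \<rho>, OF \<rho>' tight] by metis
  have \<tau>: "\<tau> \<in> decay_bounded r L"
    by (rule decay_bounded_limit[of "\<lambda>n. \<rho> (q n)"]) (use \<rho> \<open>\<tau> \<in> borel_probs\<close> lim in auto)
  have "e \<le> integral\<^sup>L \<tau> f + (LINT x|\<mu>. 1 - f x)" if f: "f \<in> \<Phi>" for f
  proof -
    have fF: "f \<in> ?F" using \<Phi>(2) f .
    have [measurable]: "f \<in> borel_measurable borel"
      using fF by (auto intro: borel_measurable_continuous_onI)
    have "(\<lambda>n. complex_of_real (integral\<^sup>L (\<rho> (q n)) f)) \<longlonglongrightarrow> complex_of_real (integral\<^sup>L \<tau> f)"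
      using lim[of "\<lambda>x. complex_of_real (f x)" 1] fF by (auto intro!: continuous_intros)
    then have "(\<lambda>n. integral\<^sup>L (\<rho> (q n)) f) \<longlonglongrightarrow> integral\<^sup>L \<tau> f"
      by (simp add: tendsto_of_real_iff)
    then have "(\<lambda>n. integral\<^sup>L (\<rho> (q n)) f + (LINT x|\<mu>. 1 - f x)) \<longlonglongrightarrow> integral\<^sup>L \<tau> f + (LINT x|\<mu>. 1 - f x)"
      by (intro tendsto_intros)
    then show ?thesis
    proof (rule LIMSEQ_le_const)
      have "e \<le> integral\<^sup>L (\<rho> (q n)) f + (LINT x|\<mu>. 1 - f x)" if n: "to_nat_on \<Phi> f \<le> n" for n
      proof -
        let ?k = "q n"
        have [measurable_cong]: "sets (\<nu> ?k) = sets borel" using borel_probsD[OF \<nu>'] by simp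
        have "n \<le> ?k" using q by (rule seq_suble)
        then have "e < separation \<mu> (\<nu> ?k) f" using n by (intro sep f) auto
        \<comment> \<open>Since \<open>m\<close> is at most 1, normalising only increases this term,
          so the lower bound e passes to the damped probability measures.\<close>
        moreover have "(LINT x|\<nu> ?k. f x * gaussian_weight x) \<le> 1 / m ?k * (LINT x|\<nu> ?k. f x * gaussian_weight x)"
        proof -
          have "0 \<le> (LINT x|\<nu> ?k. f x * gaussian_weight x)"
            using fF by (intro integral_nonneg_AE AE_I2) (auto intro!: mult_nonneg_nonneg less_imp_le[OF gaussian_weight_bounds(1)])
          moreover have "1 \<le> 1 / m ?k" using m_le[of ?k] m_pos[of ?k] by simp
          ultimately show ?thesis using mult_right_mono[of 1 "1 / m ?k"] by simp
        qed
        moreover have "1 / m ?k * (LINT x|\<nu> ?k. f x * gaussian_weight x) = integral\<^sup>L (\<rho> ?k) f"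
          unfolding \<rho>_def using m_pos[of ?k]
          by (subst integral_density)
             (auto intro!: AE_I2 divide_nonneg_pos less_imp_le[OF gaussian_weight_bounds(1)]
               simp: mult.commute simp flip: integral_divide_zero)
        ultimately show ?thesis by (simp add: separation_def)
      qed
      then show "\<exists>N. \<forall>n\<ge>N. e \<le> integral\<^sup>L (\<rho> (q n)) f + (LINT x|\<mu>. 1 - f x)" by blast
    qed
  qed
  moreover have "\<exists>f\<in>\<Phi>. integral\<^sup>L \<tau> f + (LINT x|\<mu>. 1 - f x) < e"
    by (rule singular_test_function[OF \<tau> \<open>0 < e\<close> \<Phi>(2,3)])
  ultimately show False by force
qed

text \<open>Take f_n with error 2^(-n) for the constant K = n, and let E be the set where f_n > 1/2
  eventually. Any fixed K is covered once n \<ge> K, which is enough for the Borel-Cantelli sums: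
  \<mu>-almost everywhere f_n is eventually above 1/2, and \<nu>-almost everywhere eventually
  below.\<close>

lemma common_null_set:
  "\<exists>E\<in>sets borel. emeasure \<mu> (- E) = 0 \<and> (\<forall>K. \<forall>\<nu>\<in>decay_bounded r K. emeasure \<nu> E = 0)"
proof -
  have "\<exists>f\<in>continuous_unit_functions. \<forall>\<nu>\<in>decay_bounded r (real n). separation \<mu> \<nu> f \<le> (1/2) ^ n" for n
    by (rule exists_separating_function) simp
  then have "\<exists>f. \<forall>n. f n \<in> continuous_unit_functions \<and>
      (\<forall>\<nu>\<in>decay_bounded r (real n). separation \<mu> \<nu> (f n) \<le> (1/2) ^ n)"
    by (intro choice) blast
  then obtain f where f: "\<And>n. f n \<in> continuous_unit_functions"
    and sep: "\<And>n \<nu>. \<nu> \<in> decay_bounded r (real n) \<Longrightarrow> separation \<mu> \<nu> (f n) \<le> (1/2) ^ n"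
    by blast
  have [measurable]: "f n \<in> borel_measurable borel" for n
    using f[of n] by (auto intro: borel_measurable_continuous_onI)
  have f01: "0 \<le> f n x" "f n x \<le> 1" for n x using f[of n] by auto
  have [measurable_cong]: "sets \<mu> = sets borel" by (rule \<mu>)
  have geo: "summable (\<lambda>n. 2 * (1/2 :: real) ^ n)" by (intro summable_mult summable_geometric) simp
  define E where "E = {x. \<exists>N. \<forall>n\<ge>N. 1/2 < f n x}"
  have E [measurable]: "E \<in> sets borel" unfolding E_def by measurable
  show ?thesis
  \<comment> \<open>The bound on the \<mu>-term is read off from a separation inequality at some
    \<nu>, which says nothing if the class is empty; in that case the whole space serves.\<close>
  proof (cases "\<exists>K. decay_bounded r K \<noteq> ({} :: (real ^ 'd) measure set)")
    case False
    then show ?thesis by (intro bexI[of _ UNIV]) auto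
  next
    case True
    then obtain K\<^sub>0 and \<nu>\<^sub>0 :: "(real ^ 'd) measure" where \<nu>\<^sub>0: "\<nu>\<^sub>0 \<in> decay_bounded r K\<^sub>0" by blast
    have mono: "\<nu> \<in> decay_bounded r (real n)" if "\<nu> \<in> decay_bounded r K" "nat \<lceil>K\<rceil> \<le> n" for \<nu> :: "(real ^ 'd) measure" and K n
      using that decay_bounded_mono[of K "real n"] by (auto simp: nat_ceiling_le_eq)
    have nonneg: "0 \<le> (LINT x|\<nu>. f n x * gaussian_weight x)" "0 \<le> (LINT x|\<mu>. 1 - f n x)" for \<nu> and n
      using f01 by (auto intro!: integral_nonneg_AE AE_I2 mult_nonneg_nonneg less_imp_le[OF gaussian_weight_bounds(1)])
    have "AE x in \<mu>. eventually (\<lambda>n. x \<in> space \<mu> - {x \<in> space \<mu>. 1/2 \<le> 1 - f n x}) sequentially"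
    proof (rule borel_cantelli_AE1)
      show "summable (\<lambda>n. measure \<mu> {x \<in> space \<mu>. 1/2 \<le> 1 - f n x})"
      proof (rule summable_comparison_test'[OF geo])
        fix n assume "nat \<lceil>K\<^sub>0\<rceil> \<le> n"
        then have "separation \<mu> \<nu>\<^sub>0 (f n) \<le> (1/2) ^ n" using \<nu>\<^sub>0 mono sep by blast
        then have "(LINT x|\<mu>. 1 - f n x) \<le> (1/2) ^ n" using nonneg(1)[of \<nu>\<^sub>0 n] by (simp add: separation_def)
        moreover have "measure \<mu> {x \<in> space \<mu>. 1/2 \<le> 1 - f n x} \<le> (LINT x|\<mu>. 1 - f n x) / (1/2)"
          using f01 unit_function_integrable[OF f \<mu>]
          by (intro integral_Markov_inequality_measure[where A = "{}"]) auto
        ultimately show "norm (measure \<mu> {x \<in> space \<mu>. 1/2 \<le> 1 - f n x}) \<le> 2 * (1/2) ^ n" by simp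
      qed
    qed (auto simp: \<mu>.emeasure_eq_measure)
    then have "AE x in \<mu>. x \<in> E"
      by eventually_elim (auto simp: eventually_sequentially E_def space_\<mu> not_le field_simps)
    then have "emeasure \<mu> (- E) = 0"
      by (subst (asm) AE_iff_measurable[of "- E"]) (auto simp: space_\<mu>)
    moreover have "emeasure \<nu> E = 0" if \<nu>: "\<nu> \<in> decay_bounded r K" for \<nu> K
    proof -
      have \<nu>': "\<nu> \<in> borel_probs" using \<nu> by (simp add: decay_bounded_def)
      interpret \<nu>: prob_space \<nu> using borel_probsD[OF \<nu>'] by simp
      have [measurable_cong]: "sets \<nu> = sets borel" using borel_probsD[OF \<nu>'] by simp
      have space: "space \<nu> = UNIV" using borel_probsD[OF \<nu>'] by simp
      have pos: "0 \<le> gaussian_weight x" for x :: "real ^ 'd" by (rule less_imp_le[OF gaussian_weight_bounds(1)])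
      have int: "integrable \<nu> (\<lambda>x. f n x * gaussian_weight x)" for n
        using f01
        by (intro \<nu>.integrable_const_bound[where B = 1] AE_I2)
           (auto simp: abs_mult pos gaussian_weight_bounds intro!: mult_le_one)
      \<comment> \<open>The separation controls only the weighted measure. Borel-Cantelli is applied
        to it, and positivity of the weight transfers the almost sure statement back to
        \<nu>.\<close>
      let ?\<eta> = "density \<nu> (\<lambda>x. ennreal (gaussian_weight x))"
      have \<eta>_le: "emeasure ?\<eta> {x. 1/2 \<le> f n x} \<le> ennreal (2 * (1/2) ^ n)" if "nat \<lceil>K\<rceil> \<le> n" for n
      proof -
        have "emeasure ?\<eta> {x. 1/2 \<le> f n x} = (\<integral>\<^sup>+x. ennreal (gaussian_weight x) * indicator {x. 1/2 \<le> f n x} x \<partial>\<nu>)"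
          by (rule emeasure_density) measurable
        also have "\<dots> \<le> (\<integral>\<^sup>+x. ennreal (2 * (f n x * gaussian_weight x)) \<partial>\<nu>)"
        proof (rule nn_integral_mono)
          fix x
          have "gaussian_weight x \<le> 2 * f n x * gaussian_weight x" if "1/2 \<le> f n x"
            using mult_right_mono[of 1 "2 * f n x", OF _ pos[of x]] that by simp
          then show "ennreal (gaussian_weight x) * indicator {x. 1/2 \<le> f n x} x \<le> ennreal (2 * (f n x * gaussian_weight x))"
            by (auto simp: indicator_def mult.assoc intro!: ennreal_leI)
        qed
        also have "\<dots> = ennreal (LINT x|\<nu>. 2 * (f n x * gaussian_weight x))"
          using int[of n] f01 pos by (intro nn_integral_eq_integral) auto
        also have "\<dots> \<le> ennreal (2 * (1/2) ^ n)"
        proof -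
          have "separation \<mu> \<nu> (f n) \<le> (1/2) ^ n" using \<nu> mono[OF _ that] sep by blast
          then show ?thesis using nonneg(2)[of n] by (intro ennreal_leI) (simp add: separation_def)
        qed
        finally show ?thesis .
      qed
      have fin: "emeasure ?\<eta> A < \<infinity>" for A
      proof -
        have "emeasure ?\<eta> A \<le> emeasure ?\<eta> (space ?\<eta>)" by (rule emeasure_space)
        also have "\<dots> = (\<integral>\<^sup>+x. ennreal (gaussian_weight x) * indicator (space \<nu>) x \<partial>\<nu>)"
          by (subst emeasure_density) auto
        also have "\<dots> \<le> (\<integral>\<^sup>+x. 1 \<partial>\<nu>)"
          by (rule nn_integral_mono) (auto simp: indicator_def gaussian_weight_bounds)
        also have "\<dots> < \<infinity>" by (simp add: \<nu>.emeasure_space_1)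
        finally show ?thesis .
      qed
      have "AE x in ?\<eta>. eventually (\<lambda>n. x \<in> space ?\<eta> - {x. 1/2 \<le> f n x}) sequentially"
      proof (rule borel_cantelli_AE1)
        show "summable (\<lambda>n. measure ?\<eta> {x. 1/2 \<le> f n x})"
        proof (rule summable_comparison_test'[OF geo])
          fix n assume "nat \<lceil>K\<rceil> \<le> n"
          then show "norm (measure ?\<eta> {x. 1/2 \<le> f n x}) \<le> 2 * (1/2) ^ n"
            using \<eta>_le by (simp add: measure_def enn2real_leI)
        qed
      qed (use fin in auto)
      then have "AE x in \<nu>. eventually (\<lambda>n. x \<in> space ?\<eta> - {x. 1/2 \<le> f n x}) sequentially"
        by (simp add: AE_density gaussian_weight_bounds)
      then have "AE x in \<nu>. x \<notin> E"
      proof eventually_elim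
        case (elim x)
        show ?case
        proof
          assume "x \<in> E"
          then obtain N where "\<forall>n\<ge>N. 1/2 < f n x" by (auto simp: E_def)
          moreover obtain N' where "\<forall>n\<ge>N'. \<not> 1/2 \<le> f n x"
            using elim by (auto simp: eventually_sequentially)
          ultimately show False by (metis less_imp_le max.cobounded1 max.cobounded2)
        qed
      qed
      then show ?thesis
        by (subst (asm) AE_iff_measurable[of E]) (auto simp: space)
    qed
    ultimately show ?thesis using E by blast
  qed
qed

end

section \<open>The bipolar theorems\<close>

text \<open>Exhaustion: the union of a maximising sequence attains the supremum of the measure, so
  another member cannot add mass outside it.\<close>

lemma (in finite_measure) exists_maximal_set:
  assumes "\<A> \<subseteq> sets M" "\<A> \<noteq> {}" and Union: "\<And>A :: nat \<Rightarrow> 'a set. range A \<subseteq> \<A> \<Longrightarrow> (\<Union>n. A n) \<in> \<A>"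
  shows "\<exists>A\<in>\<A>. \<forall>B\<in>\<A>. emeasure M (B - A) = 0"
proof -
  have bdd: "bdd_above (measure M ` \<A>)" by (rule bdd_aboveI[of _ "measure M (space M)"]) (auto intro: bounded_measure)
  have "\<exists>A\<in>\<A>. (SUP A\<in>\<A>. measure M A) - 1 / Suc n < measure M A" for n
    using less_cSUP_iff[OF \<open>\<A> \<noteq> {}\<close> bdd, of "(SUP A\<in>\<A>. measure M A) - 1 / Suc n"] by simp
  then obtain A where A: "\<And>n. A n \<in> \<A>" "\<And>n. (SUP A\<in>\<A>. measure M A) - 1 / Suc n < measure M (A n)"
    by metis
  have UA: "(\<Union>n. A n) \<in> \<A>" using A by (intro Union) auto
  have le: "(SUP A\<in>\<A>. measure M A) \<le> measure M (\<Union>n. A n)"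
  proof (rule LIMSEQ_le_const2)
    have "(\<lambda>n. (SUP A\<in>\<A>. measure M A) - 1 / Suc n) \<longlonglongrightarrow> (SUP A\<in>\<A>. measure M A) - 0"
      by (intro tendsto_diff tendsto_const LIMSEQ_inverse_real_of_nat[unfolded inverse_eq_divide])
    then show "(\<lambda>n. (SUP A\<in>\<A>. measure M A) - 1 / Suc n) \<longlonglongrightarrow> (SUP A\<in>\<A>. measure M A)" by simp
    have "(SUP A\<in>\<A>. measure M A) - 1 / Suc n \<le> measure M (\<Union>n. A n)" for n
      using A(2)[of n] UA assms(1) by (intro order_trans[OF less_imp_le finite_measure_mono]) auto
    then show "\<exists>N. \<forall>n\<ge>N. (SUP A\<in>\<A>. measure M A) - 1 / Suc n \<le> measure M (\<Union>n. A n)" by blast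
  qed
  have "emeasure M (B - (\<Union>n. A n)) = 0" if B: "B \<in> \<A>" for B
  proof -
    \<comment> \<open>The hypothesis concerns sequences, so a union of two sets is written as a
      sequence with \<open>B\<close> at index 0 and the other set everywhere else.\<close>
    have "range (\<lambda>n::nat. if n = 0 then B else \<Union>n. A n) \<subseteq> \<A>" using B UA by auto
    from Union[OF this] have "(\<Union>n::nat. if n = 0 then B else \<Union>n. A n) \<in> \<A>" .
    moreover have "(\<Union>n::nat. if n = 0 then B else \<Union>n. A n) = (\<Union>n. A n) \<union> (B - (\<Union>n. A n))"
      by (auto split: if_splits)
    ultimately have in\<A>: "(\<Union>n. A n) \<union> (B - (\<Union>n. A n)) \<in> \<A>" by simp
    have "measure M (\<Union>n. A n) + measure M (B - (\<Union>n. A n)) = measure M ((\<Union>n. A n) \<union> (B - (\<Union>n. A n)))"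
      using B UA assms(1) by (intro finite_measure_Union[symmetric]) auto
    also have "\<dots> \<le> (SUP A\<in>\<A>. measure M A)" by (intro cSUP_upper bdd in\<A>)
    finally have "measure M (B - (\<Union>n. A n)) \<le> 0" using le by simp
    then show ?thesis using measure_nonneg[of M] by (simp add: emeasure_eq_measure order_antisym)
  qed
  then show ?thesis using UA by blast
qed

lemma dominated_by_decay_bounded:
  fixes \<mu> :: "(real ^ 'd) measure"
  assumes \<mu>: "\<mu> \<in> borel_probs" and r: "0 \<le> r"
    and null: "\<And>E. E \<in> sets borel \<Longrightarrow> (\<And>\<nu> K. \<nu> \<in> decay_bounded r K \<Longrightarrow> emeasure \<nu> E = 0) \<Longrightarrow> emeasure \<mu> E = 0"
  shows "\<exists>K. \<exists>\<nu>\<in>decay_bounded r K. absolutely_continuous \<nu> \<mu>"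
proof -
  interpret \<mu>: prob_space \<mu> using borel_probsD[OF \<mu>] by simp
  have sets_\<mu> [measurable_cong]: "sets \<mu> = sets borel" and space_\<mu>: "space \<mu> = UNIV" using borel_probsD[OF \<mu>] by auto
  have ac: "absolutely_continuous \<nu> \<rho> \<longleftrightarrow> (\<forall>A\<in>sets borel. emeasure \<nu> A = 0 \<longrightarrow> emeasure \<rho> A = 0)"
    if "sets \<nu> = sets borel" "sets \<rho> = sets borel" for \<nu> \<rho> :: "(real ^ 'd) measure"
    using that by (auto simp: absolutely_continuous_def null_sets_def)
  have decay_sets: "sets \<nu> = sets borel" if "\<nu> \<in> decay_bounded r K" for \<nu> :: "(real ^ 'd) measure" and K
    using that borel_probsD(2) by (auto simp: decay_bounded_def)
  define dominates where
    "dominates \<nu> A \<longleftrightarrow> (\<forall>E\<in>sets borel. E \<subseteq> A \<longrightarrow> emeasure \<nu> E = 0 \<longrightarrow> emeasure \<mu> E = 0)"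
    for \<nu> and A :: "(real ^ 'd) set"
  define \<A> where "\<A> = {A \<in> sets borel. \<exists>K. \<exists>\<nu>\<in>decay_bounded r K. dominates \<nu> A}"
  \<comment> \<open>Were there no measure with decay, the whole space would vacuously be a common
    null set, although \<mu> gives it mass 1.\<close>
  have "\<exists>K. \<exists>\<nu> :: (real ^ 'd) measure. \<nu> \<in> decay_bounded r K"
  proof (rule ccontr)
    assume "\<not> (\<exists>K. \<exists>\<nu> :: (real ^ 'd) measure. \<nu> \<in> decay_bounded r K)"
    then have "emeasure \<mu> UNIV = 0" by (intro null) auto
    then show False using \<mu>.emeasure_space_1 space_\<mu> by simp
  qed
  then obtain K\<^sub>0 and \<nu>\<^sub>0 :: "(real ^ 'd) measure" where "\<nu>\<^sub>0 \<in> decay_bounded r K\<^sub>0" by blast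
  then have "{} \<in> \<A>" by (auto simp: \<A>_def dominates_def)
  have "(\<Union>n. A n) \<in> \<A>" if A: "range A \<subseteq> \<A>" for A :: "nat \<Rightarrow> (real ^ 'd) set"
  proof -
    have A_sets: "A n \<in> sets borel" for n using A by (auto simp: \<A>_def)
    have "\<exists>K \<nu>. \<nu> \<in> decay_bounded r K \<and> dominates \<nu> (A n)" for n
    proof -
      have "A n \<in> \<A>" using A by blast
      then show ?thesis unfolding \<A>_def by blast
    qed
    then have "\<exists>K. \<forall>n. \<exists>\<nu>. \<nu> \<in> decay_bounded r (K n) \<and> dominates \<nu> (A n)"
      by (intro choice) blast
    then obtain K where "\<forall>n. \<exists>\<nu>. \<nu> \<in> decay_bounded r (K n) \<and> dominates \<nu> (A n)" ..
    from choice[OF this] obtain \<nu> where \<nu>: "\<And>n. \<nu> n \<in> decay_bounded r (K n)"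
      and dom: "\<And>n. dominates (\<nu> n) (A n)" by blast
    obtain \<nu>' K' where \<nu>': "\<nu>' \<in> decay_bounded r K'" "\<And>n. absolutely_continuous \<nu>' (\<nu> n)"
      using countable_domination[of \<nu> r K, OF \<nu>] by blast
    have "emeasure \<mu> E = 0" if E: "E \<in> sets borel" "E \<subseteq> (\<Union>n. A n)" "emeasure \<nu>' E = 0" for E
    proof -
      have "emeasure \<mu> (E \<inter> A n) = 0" for n
      proof -
        have "emeasure \<nu>' (E \<inter> A n) = 0"
          by (rule emeasure_eq_0[of E]) (simp_all add: decay_sets[OF \<nu>'(1)] E(1,3))
        moreover have "E \<inter> A n \<in> sets borel" using E(1) A_sets[of n] by simp
        ultimately have "emeasure (\<nu> n) (E \<inter> A n) = 0"
          using ac[OF decay_sets[OF \<nu>'(1)] decay_sets[OF \<nu>[of n]]] \<nu>'(2)[of n] by simp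
        with \<open>E \<inter> A n \<in> sets borel\<close> show ?thesis
          using dom[of n] by (simp add: dominates_def)
      qed
      then have "(\<Union>n. E \<inter> A n) \<in> null_sets \<mu>"
        using E A_sets by (intro null_sets_UN) auto
      moreover have "(\<Union>n. E \<inter> A n) = E" using E by auto
      ultimately show ?thesis by auto
    qed
    then show ?thesis using \<nu>'(1) A_sets by (auto simp: \<A>_def dominates_def)
  qed
  note \<A>_UN = this
  obtain A where A: "A \<in> \<A>" "\<And>B. B \<in> \<A> \<Longrightarrow> emeasure \<mu> (B - A) = 0"
    using \<mu>.exists_maximal_set[of \<A>] \<A>_UN \<open>{} \<in> \<A>\<close> by (auto simp: \<A>_def sets_\<mu>)
  have [measurable]: "A \<in> sets borel" using A by (simp add: \<A>_def)
  let ?\<rho> = "density \<mu> (indicator (- A))"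
  have \<rho>: "emeasure ?\<rho> E = emeasure \<mu> (E - A)" if "E \<in> sets borel" for E
  proof -
    have "emeasure ?\<rho> E = (\<integral>\<^sup>+x. indicator (- A) x * indicator E x \<partial>\<mu>)"
      using that by (intro emeasure_density) (auto simp: sets_\<mu>)
    also have "\<dots> = (\<integral>\<^sup>+x. indicator (E - A) x \<partial>\<mu>)"
      by (rule nn_integral_cong) (auto simp: indicator_def)
    also have "\<dots> = emeasure \<mu> (E - A)"
      using that by (intro nn_integral_indicator) (auto simp: sets_\<mu>)
    finally show ?thesis .
  qed
  have "\<exists>E\<in>sets borel. emeasure ?\<rho> (- E) = 0 \<and> (\<forall>K. \<forall>\<nu>\<in>decay_bounded r K. emeasure \<nu> E = 0)"
  proof (rule common_null_set[OF _ _ r])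
    show "finite_measure ?\<rho>"
      by (rule finite_measureI) (simp add: \<rho> space_\<mu>)
    show "sets ?\<rho> = sets borel" by (simp add: sets_\<mu>)
    fix \<nu> :: "(real ^ 'd) measure" and K assume \<nu>: "\<nu> \<in> decay_bounded r K"
    \<comment> \<open>Lebesgue decomposition by exhaustion: off a largest \<nu>-null set
      \<open>N\<close>, \<mu> is dominated by \<nu>. Hence \<open>- N\<close> belongs to
      \<open>\<A>\<close>, and maximality of \<open>A\<close> leaves the restricted measure no mass
      there.\<close>
    let ?N = "{N \<in> sets borel. emeasure \<nu> N = 0}"
    have "(\<Union>n. N n) \<in> ?N" if "range N \<subseteq> ?N" for N :: "nat \<Rightarrow> (real ^ 'd) set"
    proof -
      have "(\<Union>n. N n) \<in> null_sets \<nu>" using that decay_sets[OF \<nu>] by (intro null_sets_UN) auto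
      then show ?thesis using decay_sets[OF \<nu>] by auto
    qed
    then obtain N where N: "N \<in> sets borel" "emeasure \<nu> N = 0"
      "\<And>E. E \<in> sets borel \<Longrightarrow> emeasure \<nu> E = 0 \<Longrightarrow> emeasure \<mu> (E - N) = 0"
      using \<mu>.exists_maximal_set[of ?N] by (auto simp: sets_\<mu>)
    have "dominates \<nu> (- N)"
      unfolding dominates_def using N(3) by (metis Diff_eq inf.absorb1)
    then have "- N \<in> \<A>" using \<nu> N(1) by (auto simp: \<A>_def)
    then have "emeasure ?\<rho> (- N) = 0" using A(2) N(1) \<rho>[of "- N"] by auto
    then show "\<exists>E\<in>sets borel. emeasure \<nu> E = 0 \<and> emeasure ?\<rho> (- E) = 0" using N by blast
  qed
  then obtain E where E: "E \<in> sets borel" "emeasure ?\<rho> (- E) = 0"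
    "\<And>\<nu> K. \<nu> \<in> decay_bounded r K \<Longrightarrow> emeasure \<nu> E = 0" by blast
  have "emeasure \<mu> E = 0" using E by (intro null) auto
  obtain K \<nu> where \<nu>: "\<nu> \<in> decay_bounded r K" "dominates \<nu> A" using A by (auto simp: \<A>_def)
  have "emeasure \<mu> B = 0" if B: "B \<in> sets borel" "emeasure \<nu> B = 0" for B
  proof -
    have "emeasure \<nu> (B \<inter> A) = 0"
      by (rule emeasure_eq_0[of B]) (simp_all add: decay_sets[OF \<nu>(1)] B)
    then have "B \<inter> A \<in> null_sets \<mu>"
      using \<nu>(2) B(1) by (simp add: dominates_def sets_\<mu> null_sets_def)
    moreover have "E \<in> null_sets \<mu>" using \<open>emeasure \<mu> E = 0\<close> E by (auto simp: sets_\<mu>)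
    moreover have "- E - A \<in> null_sets \<mu>" using E \<rho>[of "- E"] by (auto simp: sets_\<mu>)
    \<comment> \<open>These pieces cover \<open>B\<close>: domination handles the part in
      \<open>A\<close>, the hypothesis on \<mu> handles \<open>E\<close>, and the rest carries no
      mass of the restriction of \<mu> to the complement of \<open>A\<close>.\<close>
    ultimately have "(B \<inter> A) \<union> (E \<union> (- E - A)) \<in> null_sets \<mu>" by blast
    then have "B \<in> null_sets \<mu>"
      by (rule null_sets_subset) (use B(1) in \<open>auto simp: sets_\<mu>\<close>)
    then show ?thesis by auto
  qed
  then have "absolutely_continuous \<nu> \<mu>" using ac[OF decay_sets[OF \<nu>(1)] sets_\<mu>] by simp
  then show ?thesis using \<nu>(1) by blast
qed

lemma C_class_iff:
  assumes "0 \<le> s"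
  shows "\<mu> \<in> C_class s \<longleftrightarrow> \<mu> \<in> borel_probs \<and> (\<exists>K. \<exists>\<nu>\<in>decay_bounded (s / 2) K. absolutely_continuous \<nu> \<mu>)"
proof -
  have "\<nu> \<in> borel_probs" if "\<nu> \<in> decay_bounded (s / 2) K" for \<nu> :: "(real ^ 'a) measure" and K
    using that by (simp add: decay_bounded_def)
  then show ?thesis
    using fourier_decay_iff[OF _ assms] unfolding C_class_def by blast
qed

lemma class_subset_bipolar: "\<C> \<subseteq> borel_probs \<Longrightarrow> \<C> \<subseteq> measure_perp (null_perp \<C>)"
  by (auto simp: measure_perp_def null_perp_def)

lemma bipolar_mono: "\<C> \<subseteq> \<D> \<Longrightarrow> measure_perp (null_perp \<C>) \<subseteq> measure_perp (null_perp \<D>)"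
  by (auto simp: measure_perp_def null_perp_def)

text \<open>A set null for all measures with decay is null for everything they dominate, hence lies
  in \<open>null_perp (C_class s)\<close>. So \<mu> satisfies the hypothesis of the domination
  result.\<close>

lemma C_class_bipolar:
  assumes "0 \<le> s"
  shows "measure_perp (null_perp (C_class s :: (real ^ 'd) measure set)) = C_class s"
proof
  show "C_class s \<subseteq> measure_perp (null_perp (C_class s :: (real ^ 'd) measure set))"
    by (rule class_subset_bipolar) (auto simp: C_class_def)
  show "measure_perp (null_perp (C_class s :: (real ^ 'd) measure set)) \<subseteq> C_class s"
  proof
    fix \<mu> :: "(real ^ 'd) measure" assume "\<mu> \<in> measure_perp (null_perp (C_class s))"
    then have \<mu>: "\<mu> \<in> borel_probs" and null: "\<And>E. E \<in> null_perp (C_class s) \<Longrightarrow> emeasure \<mu> E = 0"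
      by (auto simp: measure_perp_def)
    have "\<exists>K. \<exists>\<nu>\<in>decay_bounded (s / 2) K. absolutely_continuous \<nu> \<mu>"
    proof (rule dominated_by_decay_bounded[OF \<mu>])
      fix E :: "(real ^ 'd) set"
      assume E: "E \<in> sets borel" "\<And>\<nu> K. \<nu> \<in> decay_bounded (s / 2) K \<Longrightarrow> emeasure \<nu> E = 0"
      have "emeasure \<rho> E = 0" if \<rho>: "\<rho> \<in> C_class s" for \<rho>
      proof -
        obtain K \<nu> where \<nu>: "\<nu> \<in> decay_bounded (s / 2) K" "absolutely_continuous \<nu> \<rho>"
          using \<rho> C_class_iff[OF assms] by blast
        then have "E \<in> null_sets \<nu>"
          using E borel_probsD(2)[of \<nu>] by (auto simp: decay_bounded_def)
        then show ?thesis using \<nu>(2) by (auto simp: absolutely_continuous_def)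
      qed
      then show "emeasure \<mu> E = 0" using E(1) by (intro null) (auto simp: null_perp_def)
    qed (use assms in simp)
    then show "\<mu> \<in> C_class s" using \<mu> C_class_iff[OF assms] by blast
  qed
qed

section \<open>Fourier dimensions as suprema of decay exponents\<close>

lemma fourier_decay_antimono:
  assumes \<nu>: "\<nu> \<in> borel_probs" and "fourier_decay \<nu> t" "0 \<le> s" "s \<le> t"
  shows "fourier_decay \<nu> s"
proof -
  obtain K where K: "\<nu> \<in> decay_bounded (t / 2) K"
    using fourier_decay_iff[OF \<nu>, of t] assms by auto
  have "norm (fourier_transform \<nu> \<xi>) \<le> K * (1 + norm \<xi>) powr - (s / 2)" for \<xi>
  proof -
    have "norm (fourier_transform \<nu> \<xi>) \<le> K * (1 + norm \<xi>) powr - (t / 2)"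
      using K by (simp add: decay_bounded_def)
    \<comment> \<open>The base 1 + |\<xi>| is at least 1, so lowering the exponent only weakens the
      bound; with |\<xi>| this would fail near the origin.\<close>
    also have "\<dots> \<le> K * (1 + norm \<xi>) powr - (s / 2)"
      using decay_bounded_nonneg[OF K] assms by (intro mult_left_mono powr_mono) auto
    finally show ?thesis .
  qed
  then have "\<nu> \<in> decay_bounded (s / 2) K" using \<nu> by (simp add: decay_bounded_def)
  then show ?thesis using fourier_decay_iff[OF \<nu> \<open>0 \<le> s\<close>] by blast
qed

context
  fixes \<nu> :: "(real ^ 'd) measure"
  assumes \<nu>: "\<nu> \<in> borel_probs"
begin

lemma fourier_decay_0: "fourier_decay \<nu> 0"
  using norm_fourier_transform_le_1[OF \<nu>] by (auto simp: fourier_decay_def intro!: exI[of _ 1])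

lemma fourier_dim_ge:
  assumes "0 \<le> t" "t \<le> real CARD('d)" "fourier_decay \<nu> t"
  shows "t \<le> fourier_dim \<nu>"
  unfolding fourier_dim_def
  by (rule cSup_upper) (use assms in \<open>auto intro: bdd_aboveI[of _ "real CARD('d)"]\<close>)

lemma fourier_dim_bounds: "0 \<le> fourier_dim \<nu>" "fourier_dim \<nu> \<le> real CARD('d)"
proof -
  show "0 \<le> fourier_dim \<nu>" by (rule fourier_dim_ge) (simp_all add: fourier_decay_0)
  show "fourier_dim \<nu> \<le> real CARD('d)"
    unfolding fourier_dim_def by (rule cSup_least) (use fourier_decay_0 in \<open>auto intro!: exI[of _ 0]\<close>)
qed

lemma fourier_decay_less_dim:
  assumes "0 \<le> t" "t < fourier_dim \<nu>"
  shows "fourier_decay \<nu> t"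
proof -
  have "0 \<in> {s \<in> {0..real CARD('d)}. fourier_decay \<nu> s}" by (simp add: fourier_decay_0)
  then obtain t' where "fourier_decay \<nu> t'" "t < t'"
    using less_cSupD[OF _ assms(2)[unfolded fourier_dim_def]] by blast
  then show ?thesis using fourier_decay_antimono[OF \<nu>] assms by auto
qed

end

text \<open>Neither supremum need be attained, so the characterisation uses exponents strictly below
  s. The bound on s keeps these exponents in [0, d], the range over which \<open>fourier_dim\<close>
  takes its supremum.\<close>

lemma modified_fourier_dim_ge_iff:
  fixes \<mu> :: "(real ^ 'd) measure"
  assumes \<mu>: "\<mu> \<in> borel_probs" and s: "s \<le> real CARD('d)"
  shows "s \<le> modified_fourier_dim \<mu> \<longleftrightarrow> (\<forall>t. 0 \<le> t \<and> t < s \<longrightarrow> \<mu> \<in> C_class t)"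
proof -
  let ?D = "{fourier_dim \<nu> |\<nu>. \<nu> \<in> borel_probs \<and> absolutely_continuous \<nu> \<mu>}"
  have mem: "fourier_dim \<mu> \<in> ?D" using \<mu> by (auto simp: absolutely_continuous_def)
  have bdd: "bdd_above ?D" by (rule bdd_aboveI[of _ "real CARD('d)"]) (auto simp: fourier_dim_bounds)
  show ?thesis
  proof (intro iffI allI impI)
    fix t assume "s \<le> modified_fourier_dim \<mu>" and t: "0 \<le> t \<and> t < s"
    then have "t < Sup ?D" by (simp add: modified_fourier_dim_def)
    then obtain \<nu> where "\<nu> \<in> borel_probs" "absolutely_continuous \<nu> \<mu>" "t < fourier_dim \<nu>"
      using less_cSupD[of ?D t] mem by blast
    then show "\<mu> \<in> C_class t" using \<mu> t fourier_decay_less_dim by (auto simp: C_class_def)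
  next
    assume C: "\<forall>t. 0 \<le> t \<and> t < s \<longrightarrow> \<mu> \<in> C_class t"
    have nonneg: "0 \<le> modified_fourier_dim \<mu>"
      unfolding modified_fourier_dim_def by (rule cSup_upper2[OF mem _ bdd]) (rule fourier_dim_bounds[OF \<mu>])
    show "s \<le> modified_fourier_dim \<mu>"
    proof (rule ccontr)
      assume "\<not> s \<le> modified_fourier_dim \<mu>"
      then obtain t where t: "modified_fourier_dim \<mu> < t" "t < s" using dense not_le by metis
      then have "\<mu> \<in> C_class t" using C nonneg by simp
      then obtain \<nu> where \<nu>: "\<nu> \<in> borel_probs" "absolutely_continuous \<nu> \<mu>" "fourier_decay \<nu> t"
        by (auto simp: C_class_def)
      have "t \<le> fourier_dim \<nu>" using \<nu> t s nonneg by (intro fourier_dim_ge) auto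
      also have "\<dots> \<le> modified_fourier_dim \<mu>"
        unfolding modified_fourier_dim_def using \<nu> by (intro cSup_upper bdd) auto
      finally show False using t by simp
    qed
  qed
qed

text \<open>The bipolar is monotone and fixes each \<open>C_class t\<close>, so it cannot leave
  their intersection.\<close>

lemma M_class_bipolar:
  assumes "s \<le> real CARD('d)"
  shows "measure_perp (null_perp (M_class s :: (real ^ 'd) measure set)) = M_class s"
proof
  show "M_class s \<subseteq> measure_perp (null_perp (M_class s :: (real ^ 'd) measure set))"
    by (rule class_subset_bipolar) (auto simp: M_class_def)
  show "measure_perp (null_perp (M_class s :: (real ^ 'd) measure set)) \<subseteq> M_class s"
  proof
    fix \<mu> :: "(real ^ 'd) measure" assume \<mu>: "\<mu> \<in> measure_perp (null_perp (M_class s))"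
    then have "\<mu> \<in> borel_probs" by (simp add: measure_perp_def)
    moreover have "\<mu> \<in> C_class t" if t: "0 \<le> t" "t < s" for t
    proof -
      have "M_class s \<subseteq> (C_class t :: (real ^ 'd) measure set)"
        using modified_fourier_dim_ge_iff[OF _ assms] t by (auto simp: M_class_def)
      then have "\<mu> \<in> measure_perp (null_perp (C_class t))" using \<mu> bipolar_mono by blast
      then show ?thesis by (simp only: C_class_bipolar[OF t(1)])
    qed
    ultimately show "\<mu> \<in> M_class s"
      using modified_fourier_dim_ge_iff[OF _ assms] by (auto simp: M_class_def)
  qed
qed

theorem theorem20:
  shows "(\<forall>s::real. 0 \<le> s \<longrightarrow>
            measure_perp (null_perp (C_class s :: (real ^ 'd) measure set)) = C_class s) \<and>
         (\<forall>s::real. 0 \<le> s \<and> s \<le> real CARD('d) \<longrightarrow>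
            measure_perp (null_perp (M_class s :: (real ^ 'd) measure set)) = M_class s)"
  using C_class_bipolar M_class_bipolar by blast

end
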